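(* Let $n\ge0$, and let $\mathcal{H}^\alpha_n(SG)=\mathcal{F}^\alpha(\mathcal{H}_n(SG))\subset\mathcal{C}(SG)$ be the space of all $\alpha$-fractal polynomials on $SG$. Then: (i) $\mathcal{H}^\alpha_n(SG)$ is a proximinal subset of $\mathcal{C}(SG)$; in fact it is strongly proximinal. (ii) For each $f\in\mathcal{C}(SG)$, the set of best approximants $P_{\mathcal{H}^\alpha_n(SG)}(f)$ is closed and convex; in particular it is weakly closed. (iii) The (set-valued) metric projection $P_{\mathcal{H}^\alpha_n(SG)}:\mathcal{C}(SG)\to\mathcal{H}^\alpha_n(SG)$ is upper semicontinuous, closed, and locally bounded. (iv) $P_{\mathcal{H}^\alpha_n(SG)}$ has a first Baire class selector $\mathcal{J}:\mathcal{C}(SG)\to\mathcal{H}^\alpha_n(SG)$, and the set of points where $\mathcal{J}$ is norm-discontinuous is an $F_\sigma$-set of first category in $\mathcal{C}(SG)$.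
   Context: Let $V_0=\{p_1,p_2,p_3\}$ be the vertices of an equilateral triangle in $\mathbb{R}^2$, $L_i(t)=\frac12(t+p_i)$ for $i\in I=\{1,2,3\}$, $SG$ the unique nonempty compact set with $SG=\bigcup_{i=1}^3L_i(SG)$, and $L_\omega=L_{\omega_1}\circ\cdots\circ L_{\omega_m}$ for $\omega\in I^m$. $\mathcal{C}(SG)$ carries the sup norm. Laplacian and polynomials: $V_m=\bigcup_{\omega\in I^m}L_\omega(V_0)$; distinct $x,y\in V_m$ satisfy $x\sim_my$ iff $x,y\in L_\omega(V_0)$ for some $\omega\in I^m$; $E(f)=\lim_m(5/3)^m\sum_{x\sim_my}(f(x)-f(y))^2$; $\mathrm{dom}(\mathcal{E})$ is the set of continuous $f$ on $SG$ with $E(f)<\infty$; $\mathcal{E}(f,g)=\lim_m(5/3)^m\sum_{x\sim_my}(f(x)-f(y))(g(x)-g(y))$; $\mathrm{dom}_0(\mathcal{E})=\{f\in\mathrm{dom}(\mathcal{E}):f|_{V_0}=0\}$. Let $\mu_p$ be the unique Borel probability measure on $SG$ with $\mu_p=\frac13\sum_{i=1}^3\mu_p\circ L_i^{-1}$. For $f\in\mathrm{dom}(\mathcal{E})$ and $g$ continuous, $f\in\mathrm{dom}\,\Delta$ with $\Delta f=g$ means $\mathcal{E}(f,h)=-\int_{SG}gh\,d\mu_p$ for all $h\in\mathrm{dom}_0(\mathcal{E})$. Put $\mathcal{H}_n(SG)=\{f:\Delta^{n+1}f=0\}$ (a space of dimension $3(n+1)$). Fractal operator: fix $N\ge1$,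 functions $\alpha_\omega\in\mathcal{C}(SG)$ ($\omega\in I^N$) with $\|\alpha_\omega\|_\infty<1$, and a bounded linear operator $L:\mathcal{C}(SG)\to\mathcal{C}(SG)$ with $(Lf)|_{V_0}=f|_{V_0}$ for all $f$. $\mathcal{F}^\alpha(f)=f^\alpha$ is the unique continuous function with $f^\alpha(L_\omega(t))=f(L_\omega(t))+\alpha_\omega(t)(f^\alpha-Lf)(t)$ for all $t\in SG$, $\omega\in I^N$; $\mathcal{F}^\alpha$ is a bounded linear operator on $\mathcal{C}(SG)$. Approximation notions: for a subset $W$ of a normed space $Y$, $d(f,W)=\inf_{w\in W}\|f-w\|$ and $P_W(f)=\{w\in W:\|f-w\|=d(f,W)\}$. $W$ is proximinal if $P_W(f)\neq\emptyset$ for all $f\in Y$; strongly proximinal if moreover for every $f\in Y$ and $\epsilon>0$ there is $\delta>0$ such that $w\in W$, $\|f-w\|<d(f,W)+\delta$ imply $d(w,P_W(f))<\epsilon$. The set-valued map $P_W$ is upper semicontinuous if $\{f:P_W(f)\subset U\}$ is open for each open $U\subset W$; closed if its graph is closed (i.e. $f_\lambda\to f$, $w_\lambda\in P_W(f_\lambda)$, $w_\lambda\to w$ imply $w\in P_W(f)$); locally bounded if each point of $Y$ has a neighbourhood $B$ with $\bigcup_{f\in B}P_W(f)$ bounded. A selector of $P_W$ is a map $\mathcal{J}$ with $\mathcal{J}(f)\in P_W(f)$ for all $f$; it is of first Baire class if it is a pointwise limit of a sequence of continuous maps. *)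

theory Defs
  imports "HOL-Probability.Probability" "HOL-Library.Numeral_Type"
begin

section \<open>The Sierpinski gasket\<close>

text \<open>
  The index set $I$ is the three-element type \<^typ>\<open>3\<close>, and a word in $I^m$ is a list of length $m$.
  Since the gasket depends on the triangle \<open>p\<close>, it cannot be made a type for all triangles at once.
  The points of the gasket are therefore the elements of a type \<open>'a\<close> together with a homeomorphism
  \<open>e\<close> from \<open>'a\<close> onto the gasket in the plane, so that $C(SG)$ with the sup norm is the
  Banach space \<open>'a \<Rightarrow>\<^sub>C real\<close>. Below, \<open>inv e\<close> is only ever applied to points of the gasket.
\<close>

definition equilateral :: "(3 \<Rightarrow> real^2) \<Rightarrow> bool" where
  "equilateral p \<longleftrightarrow> (\<exists>s>0. \<forall>i j. i \<noteq> j \<longrightarrow> dist (p i) (p j) = s)"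

definition contraction :: "(3 \<Rightarrow> real^2) \<Rightarrow> 3 \<Rightarrow> real^2 \<Rightarrow> real^2" where
  "contraction p i t = (1/2) *\<^sub>R (t + p i)"

definition cell_map :: "(3 \<Rightarrow> real^2) \<Rightarrow> ('a \<Rightarrow> real^2) \<Rightarrow> 3 \<Rightarrow> 'a \<Rightarrow> 'a" where
  "cell_map p e i t = inv e (contraction p i (e t))"

definition word_map :: "(3 \<Rightarrow> real^2) \<Rightarrow> ('a \<Rightarrow> real^2) \<Rightarrow> 3 list \<Rightarrow> 'a \<Rightarrow> 'a" where
  "word_map p e \<omega> = foldr (cell_map p e) \<omega>"

definition boundary_vertices :: "(3 \<Rightarrow> real^2) \<Rightarrow> ('a \<Rightarrow> real^2) \<Rightarrow> 'a set" where
  "boundary_vertices p e = e -` range p"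

definition vertices :: "(3 \<Rightarrow> real^2) \<Rightarrow> ('a \<Rightarrow> real^2) \<Rightarrow> nat \<Rightarrow> 'a set" where
  "vertices p e m = (\<Union>\<omega>\<in>{\<omega>. length \<omega> = m}. word_map p e \<omega> ` boundary_vertices p e)"

definition adjacent :: "(3 \<Rightarrow> real^2) \<Rightarrow> ('a \<Rightarrow> real^2) \<Rightarrow> nat \<Rightarrow> 'a \<Rightarrow> 'a \<Rightarrow> bool" where
  "adjacent p e m x y \<longleftrightarrow> x \<in> vertices p e m \<and> y \<in> vertices p e m \<and> x \<noteq> y \<and>
     (\<exists>\<omega>. length \<omega> = m \<and> x \<in> word_map p e \<omega> ` boundary_vertices p e
                       \<and> y \<in> word_map p e \<omega> ` boundary_vertices p e)"

section \<open>Energy, Laplacian and fractal polynomials\<close>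

text \<open>The energy sums over unordered pairs of neighbours; the factor $1/2$ compensates for summing
  over ordered pairs.\<close>

definition level_energy ::
  "(3 \<Rightarrow> real^2) \<Rightarrow> ('a \<Rightarrow> real^2) \<Rightarrow> nat \<Rightarrow> ('a \<Rightarrow> real) \<Rightarrow> ('a \<Rightarrow> real) \<Rightarrow> real" where
  "level_energy p e m f g =
     (5/3) ^ m * ((1/2) * (\<Sum>(x, y) | adjacent p e m x y. (f x - f y) * (g x - g y)))"

definition energy :: "(3 \<Rightarrow> real^2) \<Rightarrow> ('a \<Rightarrow> real^2) \<Rightarrow> ('a \<Rightarrow> real) \<Rightarrow> ereal" where
  "energy p e f = lim (\<lambda>m. ereal (level_energy p e m f f))"

definition energy_form ::
  "(3 \<Rightarrow> real^2) \<Rightarrow> ('a \<Rightarrow> real^2) \<Rightarrow> ('a \<Rightarrow> real) \<Rightarrow> ('a \<Rightarrow> real) \<Rightarrow> real" where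
  "energy_form p e f g = lim (\<lambda>m. level_energy p e m f g)"

definition dom_energy ::
  "(3 \<Rightarrow> real^2) \<Rightarrow> ('a::topological_space \<Rightarrow> real^2) \<Rightarrow> ('a \<Rightarrow>\<^sub>C real) set" where
  "dom_energy p e = {f :: 'a \<Rightarrow>\<^sub>C real. energy p e f < \<infinity>}"

definition dom0_energy ::
  "(3 \<Rightarrow> real^2) \<Rightarrow> ('a::topological_space \<Rightarrow> real^2) \<Rightarrow> ('a \<Rightarrow>\<^sub>C real) set" where
  "dom0_energy p e = {f \<in> dom_energy p e. \<forall>t\<in>boundary_vertices p e. f t = 0}"

definition self_similar_measure ::
  "(3 \<Rightarrow> real^2) \<Rightarrow> ('a::topological_space \<Rightarrow> real^2) \<Rightarrow> 'a measure \<Rightarrow> bool" where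
  "self_similar_measure p e \<mu> \<longleftrightarrow> prob_space \<mu> \<and> sets \<mu> = sets borel \<and>
     (\<forall>A\<in>sets borel. measure \<mu> A = (1/3) * (\<Sum>i\<in>UNIV. measure \<mu> (cell_map p e i -` A)))"

text \<open>\<open>is_laplacian p e \<mu> f g\<close> says that $f \in \mathrm{dom}\,\Delta$ and $\Delta f = g$.\<close>

definition is_laplacian ::
  "(3 \<Rightarrow> real^2) \<Rightarrow> ('a::topological_space \<Rightarrow> real^2) \<Rightarrow> 'a measure \<Rightarrow>
   ('a \<Rightarrow>\<^sub>C real) \<Rightarrow> ('a \<Rightarrow>\<^sub>C real) \<Rightarrow> bool" where
  "is_laplacian p e \<mu> f g \<longleftrightarrow> f \<in> dom_energy p e \<and>
     (\<forall>h\<in>dom0_energy p e. energy_form p e f h = - (\<integral>t. g t * h t \<partial>\<mu>))"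

text \<open>$\Delta^{n+1} f = 0$ is expressed by the $(n+1)$-fold composition of the relation
  \<^const>\<open>is_laplacian\<close>.\<close>

definition polynomials ::
  "(3 \<Rightarrow> real^2) \<Rightarrow> ('a::topological_space \<Rightarrow> real^2) \<Rightarrow> 'a measure \<Rightarrow> nat \<Rightarrow> ('a \<Rightarrow>\<^sub>C real) set" where
  "polynomials p e \<mu> n = {f. (is_laplacian p e \<mu> ^^ Suc n) f 0}"

definition fractal_operator ::
  "(3 \<Rightarrow> real^2) \<Rightarrow> ('a::topological_space \<Rightarrow> real^2) \<Rightarrow> nat \<Rightarrow> (3 list \<Rightarrow> ('a \<Rightarrow>\<^sub>C real)) \<Rightarrow>
   (('a \<Rightarrow>\<^sub>C real) \<Rightarrow> ('a \<Rightarrow>\<^sub>C real)) \<Rightarrow> ('a \<Rightarrow>\<^sub>C real) \<Rightarrow> ('a \<Rightarrow>\<^sub>C real)" where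
  "fractal_operator p e N \<alpha> L f = (THE g :: 'a \<Rightarrow>\<^sub>C real. \<forall>\<omega> t. length \<omega> = N \<longrightarrow>
     g (word_map p e \<omega> t) = f (word_map p e \<omega> t) + \<alpha> \<omega> t * (g t - L f t))"

definition fractal_polynomials ::
  "(3 \<Rightarrow> real^2) \<Rightarrow> ('a::topological_space \<Rightarrow> real^2) \<Rightarrow> 'a measure \<Rightarrow> nat \<Rightarrow>
   (3 list \<Rightarrow> ('a \<Rightarrow>\<^sub>C real)) \<Rightarrow> (('a \<Rightarrow>\<^sub>C real) \<Rightarrow> ('a \<Rightarrow>\<^sub>C real)) \<Rightarrow> nat \<Rightarrow> ('a \<Rightarrow>\<^sub>C real) set" where
  "fractal_polynomials p e \<mu> N \<alpha> L n = fractal_operator p e N \<alpha> L ` polynomials p e \<mu> n"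

section \<open>Best approximation\<close>

definition metric_proj :: "'y::real_normed_vector set \<Rightarrow> 'y \<Rightarrow> 'y set" where
  "metric_proj W f = {w \<in> W. norm (f - w) = infdist f W}"

definition proximinal :: "'y::real_normed_vector set \<Rightarrow> bool" where
  "proximinal W \<longleftrightarrow> (\<forall>f. metric_proj W f \<noteq> {})"

definition strongly_proximinal :: "'y::real_normed_vector set \<Rightarrow> bool" where
  "strongly_proximinal W \<longleftrightarrow> proximinal W \<and>
     (\<forall>f. \<forall>\<epsilon>>0. \<exists>\<delta>>0. \<forall>w\<in>W. norm (f - w) < infdist f W + \<delta> \<longrightarrow> infdist w (metric_proj W f) < \<epsilon>)"

definition weak_topology :: "'y::real_normed_vector topology" where
  "weak_topology = topology_generated_by {\<phi> -` U |\<phi> U. bounded_linear (\<phi> :: 'y \<Rightarrow> real) \<and> open U}"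

definition upper_semicont_into ::
  "'y::topological_space set \<Rightarrow> ('x::topological_space \<Rightarrow> 'y set) \<Rightarrow> bool" where
  "upper_semicont_into W P \<longleftrightarrow> (\<forall>U. openin (top_of_set W) U \<longrightarrow> open {f. P f \<subseteq> U})"

definition closed_graph :: "('x::topological_space \<Rightarrow> 'y::topological_space set) \<Rightarrow> bool" where
  "closed_graph P \<longleftrightarrow> closed {(f, w). w \<in> P f}"

definition locally_bounded :: "('x::topological_space \<Rightarrow> 'y::metric_space set) \<Rightarrow> bool" where
  "locally_bounded P \<longleftrightarrow> (\<forall>f. \<exists>B. open B \<and> f \<in> B \<and> bounded (\<Union>g\<in>B. P g))"

definition first_baire_class_into ::
  "'y::topological_space set \<Rightarrow> ('x::topological_space \<Rightarrow> 'y) \<Rightarrow> bool" where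
  "first_baire_class_into W J \<longleftrightarrow> (\<exists>F :: nat \<Rightarrow> 'x \<Rightarrow> 'y.
     (\<forall>k. continuous_on UNIV (F k) \<and> range (F k) \<subseteq> W) \<and> (\<forall>f. (\<lambda>k. F k f) \<longlonglongrightarrow> J f))"

definition first_category :: "'x::topological_space set \<Rightarrow> bool" where
  "first_category S \<longleftrightarrow> (\<exists>A :: nat \<Rightarrow> 'x set. S = (\<Union>k. A k) \<and> (\<forall>k. interior (closure (A k)) = {}))"

end

theory Submission
  imports Defs
begin

text \<open>
  All four assertions hold for every finite-dimensional subspace of a space of bounded continuous
  functions, so the proof has two independent halves: the approximation theory of such subspaces,
  and the finite-dimensionality of the space of fractal polynomials.

  The approximation theory is compactness. If $w_k \in W$ is almost nearest to $f_k$ and $f_k \to f$,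
  then $(w_k)$ is bounded and so has a subsequence converging to a best approximant of $f$
  (\<open>near_best_subsequence\<close>). Proximinality, strong proximinality, compactness of the sets of best
  approximants and upper semicontinuity of the metric projection are all instances of this. A compact
  set of functions is weakly closed because point evaluations already separate functions, which makes
  the weak topology Hausdorff. The selector $J$ picks the best approximant that minimises a strictly
  convex function $q$. It is the pointwise limit, as $\epsilon \to 0$, of the unique minimisers of
  $\|f - w\| + \epsilon\, q(w)$ over $W$, and these depend continuously on $f$
  (\<open>continuous_minimiser\<close>, \<open>minimiser_tendsto_selector\<close>). The discontinuities of any pointwise limit of
  continuous maps form an $F_\sigma$ set of first category.

  For the second half, a function with $\Delta f = 0$ that vanishes on $V_0$ has energy zero and
  therefore vanishes at all vertices, which are dense. So the kernel of $\Delta$ embeds in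
  $\mathbb{R}^3$, and by induction $\Delta^{n+1}$ has finite-dimensional kernel
  (\<open>polynomials_finite_dim\<close>). This needs $\mathcal{E}$ to be bilinear, that is, the limits
  defining it to exist, which rests on the monotonicity of the level energies
  (\<open>level_energy_mono\<close>). Finally the fractal operator must be well defined and linear on all of
  $\mathcal{C}(SG)$: different cells of the same level meet only in images of boundary vertices
  (\<open>word_meet\<close>), where the prescribed values agree, so that the functional equation is a fixed-point
  equation of a contraction.
\<close>

section \<open>Finite-dimensional subspaces\<close>

lemma LIMSEQ_norm_bounded:
  fixes x :: "nat \<Rightarrow> 'y::real_normed_vector"
  assumes "x \<longlonglongrightarrow> l"
  obtains K where "\<And>n. norm (x n) \<le> K"
  using convergent_imp_Bseq[OF convergentI[OF assms]] by (metis BseqE)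

lemma lim_1_over_Suc: "(\<lambda>k. 1 / real (Suc k)) \<longlonglongrightarrow> 0"
  using LIMSEQ_Suc[OF lim_1_over_n] .

lemma closed_if_compact_balls:
  fixes S :: "'y::real_normed_vector set"
  assumes "\<And>r. compact (S \<inter> cball 0 r)"
  shows "closed S"
  unfolding closed_sequential_limits
proof (intro allI impI, elim conjE)
  fix x l assume x: "\<forall>n. x n \<in> S" and lim: "x \<longlonglongrightarrow> l"
  obtain K where K: "\<And>n. norm (x n) \<le> K"
    using LIMSEQ_norm_bounded[OF lim] by blast
  have "closed (S \<inter> cball 0 K)" using assms compact_imp_closed by blast
  moreover have "\<And>n. x n \<in> S \<inter> cball 0 K" using x K by auto
  ultimately show "l \<in> S" using lim closed_sequentially by blast
qed

text \<open>
  In the induction step $b \notin \mathrm{span}\,B$ has positive distance $d$ from the closed subspace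
  $\mathrm{span}\,B$, so $|c|\,d \le \|v + c b\|$ bounds the coefficient $c$ and hence also $v$. The ball
  is then a closed subset of the image of a compact product.
\<close>

lemma compact_span_cball:
  fixes B :: "'y::real_normed_vector set"
  assumes "finite B"
  shows "compact (span B \<inter> cball 0 r)"
  using assms
proof (induction B arbitrary: r)
  case empty
  then show ?case by (auto intro: finite_imp_compact)
next
  case (insert b B)
  have cl: "closed (span B)" by (rule closed_if_compact_balls) (rule insert.IH)
  show ?case
  proof (cases "b \<in> span B")
    case True
    then show ?thesis using insert.IH span_redundant by metis
  next
    case False
    define d where "d = infdist b (span B)"
    have d: "d > 0"
      using False cl infdist_pos_not_in_closed[of "span B" b] span_zero unfolding d_def by auto
    \<comment> \<open>the distance of $-c\,b$ from the span of $B$ is $|c|\,d$\<close>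
    have low: "\<bar>c\<bar> * d \<le> norm (v + c *\<^sub>R b)" if "v \<in> span B" for v c
    proof (cases "c = 0")
      case False
      have "(- 1 / c) *\<^sub>R v \<in> span B" using that span_scale by blast
      then have "d \<le> norm (b - (- 1 / c) *\<^sub>R v)"
        using infdist_le unfolding d_def by (metis dist_norm)
      also have "b - (- 1 / c) *\<^sub>R v = (1 / c) *\<^sub>R (v + c *\<^sub>R b)" using False
        by (simp add: algebra_simps)
      finally have "d \<le> norm (v + c *\<^sub>R b) / \<bar>c\<bar>" by (simp add: divide_inverse mult.commute)
      then show ?thesis using False by (simp add: field_simps)
    qed simp
    define R where "R = max r 0"
    define K where "K = (\<lambda>(v, c). v + c *\<^sub>R b) `
      ((span B \<inter> cball 0 (R + R / d * norm b)) \<times> {- R / d .. R / d})"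
    have "compact K" unfolding K_def
      by (intro compact_continuous_image compact_Times insert.IH compact_Icc)
        (auto intro!: continuous_intros simp: case_prod_unfold)
    moreover have "span (insert b B) \<inter> cball 0 r = K \<inter> cball 0 r"
    proof (intro equalityI subsetI)
      fix w assume w: "w \<in> span (insert b B) \<inter> cball 0 r"
      then obtain c where c: "w - c *\<^sub>R b \<in> span B" using span_breakdown_eq by blast
      define v where "v = w - c *\<^sub>R b"
      have wv: "w = v + c *\<^sub>R b" by (simp add: v_def)
      have "\<bar>c\<bar> * d \<le> R" using low[of v c] c w wv unfolding R_def v_def by auto
      then have cR: "\<bar>c\<bar> \<le> R / d" using d by (simp add: field_simps)
      have "norm v \<le> norm w + \<bar>c\<bar> * norm b" unfolding v_def
        by (metis norm_scaleR norm_triangle_ineq4)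
      also have "\<dots> \<le> R + R / d * norm b"
        using w cR by (intro add_mono mult_right_mono) (auto simp: R_def)
      finally show "w \<in> K \<inter> cball 0 r"
        using w c cR wv unfolding K_def v_def[symmetric]
        by (auto intro!: image_eqI[of _ _ "(v, c)"])
    next
      fix w assume w: "w \<in> K \<inter> cball 0 r"
      then obtain v c where "v \<in> span B" "w = v + c *\<^sub>R b" unfolding K_def by auto
      then show "w \<in> span (insert b B) \<inter> cball 0 r"
        using w span_breakdown_eq[of w b B] by (metis IntD2 IntI add_diff_cancel_right')
    qed
    ultimately show ?thesis by (simp add: compact_Int_closed)
  qed
qed

lemma subspace_of_finite_span:
  fixes V :: "'y::real_vector set"
  assumes "subspace V" "finite B" "V \<subseteq> span B"
  obtains C where "finite C" "span C = V"
proof -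
  obtain C where C: "C \<subseteq> V" "independent C" "V \<subseteq> span C"
    using basis_exists[of V] by metis
  have "finite C" using independent_span_bound[of B C] assms C by blast
  moreover have "span C = V" using C assms span_minimal by blast
  ultimately show ?thesis using that by blast
qed

section \<open>Best approximation from a boundedly compact set\<close>

text \<open>
  Turns uniqueness of cluster points into convergence. It is used twice for minimisers, which are
  unique and stay in a compact set.
\<close>

lemma tendsto_if_subsequences_tendsto:
  fixes x :: "nat \<Rightarrow> 'y::topological_space"
  assumes "\<And>r :: nat \<Rightarrow> nat. strict_mono r \<Longrightarrow> \<exists>s. strict_mono s \<and> (\<lambda>n. x (r (s n))) \<longlonglongrightarrow> l"
  shows "x \<longlonglongrightarrow> l"
proof (rule ccontr)
  assume "\<not> x \<longlonglongrightarrow> l"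
  then obtain U where U: "open U" "l \<in> U" "\<not> (\<forall>\<^sub>F n in sequentially. x n \<in> U)"
    unfolding tendsto_def by blast
  obtain r :: "nat \<Rightarrow> nat" where r: "strict_mono r" "\<And>n. x (r n) \<notin> U"
    using not_eventually_sequentiallyD[OF U(3)] by blast
  obtain s where "(\<lambda>n. x (r (s n))) \<longlonglongrightarrow> l" using assms[OF r(1)] by blast
  then have "\<forall>\<^sub>F n in sequentially. x (r (s n)) \<in> U"
    using U unfolding tendsto_def by blast
  then show False using r(2) by simp
qed

text \<open>
  Finite-dimensional subspaces enter the theory of best approximation only through the compactness of
  their bounded closed parts.
\<close>

locale boundedly_compact =
  fixes W :: "'y::real_normed_vector set"
  assumes compact_balls: "compact (W \<inter> cball 0 r)" and nonempty: "W \<noteq> {}"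
begin

lemma closed_W: "closed W"
  using closed_if_compact_balls compact_balls by blast

lemma bounded_subsequence:
  assumes "\<And>k::nat. w k \<in> W" "bounded (range w)"
  obtains s l where "strict_mono s" "l \<in> W" "(\<lambda>k. w (s k)) \<longlonglongrightarrow> l"
proof -
  obtain K where K: "\<And>k. norm (w k) \<le> K" using assms(2) unfolding bounded_iff by blast
  then have "\<forall>k. w k \<in> W \<inter> cball 0 K" using assms by auto
  then obtain l s where "l \<in> W \<inter> cball 0 K" "strict_mono s" "(w \<circ> s) \<longlonglongrightarrow> l"
    using compact_balls[of K] unfolding compact_def by metis
  then show ?thesis using that[of s l] by (simp add: comp_def)
qed

text \<open>
  The sequence $(w_k)$ is bounded, and the distance to $W$ is continuous, so the estimate passes to the
  limit of a convergent subsequence. The point being approximated is allowed to vary with $k$ for the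
  sake of upper semicontinuity.
\<close>

lemma near_best_subsequence:
  assumes "\<And>k::nat. w k \<in> W" "f \<longlonglongrightarrow> f0" "\<delta> \<longlonglongrightarrow> 0"
    and near: "\<And>k. norm (f k - w k) \<le> infdist (f k) W + \<delta> k"
  obtains s l where "strict_mono s" "l \<in> metric_proj W f0" "(\<lambda>k. w (s k)) \<longlonglongrightarrow> l"
proof -
  have rhs: "(\<lambda>k. infdist (f k) W + \<delta> k) \<longlonglongrightarrow> infdist f0 W"
    using tendsto_add[OF tendsto_infdist[OF assms(2)] assms(3)] by simp
  obtain K1 where K1: "\<And>k. norm (infdist (f k) W + \<delta> k) \<le> K1"
    using LIMSEQ_norm_bounded[OF rhs] by blast
  obtain K2 where K2: "\<And>k. norm (f k) \<le> K2"
    using LIMSEQ_norm_bounded[OF assms(2)] by blast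
  have "norm (w k) \<le> K1 + K2" for k
  proof -
    have "norm (w k) \<le> norm (f k - w k) + norm (f k)"
      by (metis norm_minus_commute norm_triangle_sub add.commute)
    then show ?thesis using near[of k] K1[of k] K2[of k] by simp
  qed
  then have "bounded (range w)" unfolding bounded_iff by blast
  then obtain s l where s: "strict_mono s" "l \<in> W" "(\<lambda>k. w (s k)) \<longlonglongrightarrow> l"
    using bounded_subsequence assms(1) by metis
  have fs: "(\<lambda>k. f (s k)) \<longlonglongrightarrow> f0" using LIMSEQ_subseq_LIMSEQ[OF assms(2) s(1)] by (simp add: comp_def)
  have "norm (f0 - l) \<le> infdist f0 W"
  proof (rule LIMSEQ_le)
    show "(\<lambda>k. norm (f (s k) - w (s k))) \<longlonglongrightarrow> norm (f0 - l)"
      by (intro tendsto_intros fs s(3))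
    show "(\<lambda>k. infdist (f (s k)) W + \<delta> (s k)) \<longlonglongrightarrow> infdist f0 W"
      using LIMSEQ_subseq_LIMSEQ[OF rhs s(1)] by (simp add: comp_def)
  qed (use near in auto)
  then have "l \<in> metric_proj W f0"
    using s(2) infdist_le[OF s(2), of f0] unfolding metric_proj_def by (auto simp: dist_norm)
  then show ?thesis using that s by blast
qed

lemma infdist_approx:
  assumes "\<delta> > 0"
  shows "\<exists>w\<in>W. norm (f - w) < infdist f W + \<delta>"
proof (rule ccontr)
  assume "\<not> ?thesis"
  then have "infdist f W + \<delta> \<le> infdist f W"
    unfolding infdist_notempty[OF nonempty]
    by (intro cINF_greatest nonempty) (auto simp: dist_norm not_less infdist_notempty[OF nonempty])
  then show False using assms by simp
qed

lemma metric_proj_nonempty: "metric_proj W f \<noteq> {}"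
proof -
  obtain w where w: "\<And>k::nat. w k \<in> W \<and> norm (f - w k) < infdist f W + 1 / Suc k"
    using infdist_approx[of "1 / Suc _" f] by (metis of_nat_0_less_iff zero_less_Suc zero_less_divide_1_iff)
  show ?thesis
    by (rule near_best_subsequence[OF _ tendsto_const lim_1_over_Suc, of w f])
      (use w in \<open>auto intro: less_imp_le\<close>)
qed

lemma proximinal: "proximinal W"
  unfolding proximinal_def using metric_proj_nonempty by blast

lemma strongly_proximinal: "strongly_proximinal W"
  unfolding strongly_proximinal_def
proof (intro conjI allI impI proximinal, rule ccontr)
  fix f and \<epsilon> :: real assume \<epsilon>: "\<epsilon> > 0"
  assume "\<not> (\<exists>\<delta>>0. \<forall>w\<in>W. norm (f - w) < infdist f W + \<delta> \<longrightarrow> infdist w (metric_proj W f) < \<epsilon>)"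
  then have "\<forall>k::nat. \<exists>w\<in>W. norm (f - w) < infdist f W + 1 / Suc k \<and> \<epsilon> \<le> infdist w (metric_proj W f)"
    by (metis not_less of_nat_0_less_iff zero_less_Suc zero_less_divide_1_iff)
  then obtain w where w: "\<And>k::nat. w k \<in> W \<and> norm (f - w k) < infdist f W + 1 / Suc k
      \<and> \<epsilon> \<le> infdist (w k) (metric_proj W f)" by metis
  obtain s l where s: "strict_mono s" "l \<in> metric_proj W f" "(\<lambda>k. w (s k)) \<longlonglongrightarrow> l"
    by (rule near_best_subsequence[OF _ tendsto_const lim_1_over_Suc, of w f])
      (use w in \<open>auto intro: less_imp_le\<close>)
  have "(\<lambda>k. infdist (w (s k)) (metric_proj W f)) \<longlonglongrightarrow> infdist l (metric_proj W f)"
    by (intro tendsto_infdist s(3))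
  then have "\<epsilon> \<le> infdist l (metric_proj W f)"
    by (rule LIMSEQ_le_const) (use w in blast)
  then show False using \<epsilon> s(2) by simp
qed

lemma compact_metric_proj: "compact (metric_proj W f)"
  unfolding compact_def
proof (intro allI impI)
  fix w :: "nat \<Rightarrow> 'y" assume w: "\<forall>k. w k \<in> metric_proj W f"
  show "\<exists>l\<in>metric_proj W f. \<exists>r. strict_mono r \<and> (w \<circ> r) \<longlonglongrightarrow> l"
    by (rule near_best_subsequence[of w "\<lambda>_. f" f "\<lambda>_. 0"])
      (use w in \<open>auto simp: metric_proj_def comp_def\<close>)
qed

lemma upper_semicont: "upper_semicont_into W (metric_proj W)"
  unfolding upper_semicont_into_def
proof (intro allI impI)
  fix U assume "openin (top_of_set W) U"
  then obtain T where T: "open T" "U = W \<inter> T" unfolding openin_open by blast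
  have "closed {f. \<not> metric_proj W f \<subseteq> U}" unfolding closed_sequential_limits
  proof (intro allI impI, elim conjE)
    fix f f0 assume f: "\<forall>k. f k \<in> {f. \<not> metric_proj W f \<subseteq> U}" and lim: "f \<longlonglongrightarrow> f0"
    then have "\<forall>k. \<exists>w. w \<in> metric_proj W (f k) \<and> w \<notin> U" by blast
    then obtain w where w: "\<And>k. w k \<in> metric_proj W (f k) \<and> w k \<notin> U" by metis
    obtain s l where s: "strict_mono s" "l \<in> metric_proj W f0" "(\<lambda>k. w (s k)) \<longlonglongrightarrow> l"
      by (rule near_best_subsequence[of w f f0 "\<lambda>_. 0"])
        (use w lim in \<open>auto simp: metric_proj_def\<close>)
    have "\<And>k. w (s k) \<in> - T" using w T(2) unfolding metric_proj_def by auto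
    then have "l \<in> - T" using closed_sequentially[OF closed_Compl[OF T(1)] _ s(3)] by blast
    then show "f0 \<in> {f. \<not> metric_proj W f \<subseteq> U}" using s(2) T(2) by auto
  qed
  then show "open {f. metric_proj W f \<subseteq> U}" by (simp add: closed_def Compl_eq)
qed

lemma closed_graph: "closed_graph (metric_proj W)"
proof -
  have "{(f, w). w \<in> metric_proj W f} = (UNIV \<times> W) \<inter> {x. norm (fst x - snd x) = infdist (fst x) W}"
    unfolding metric_proj_def by auto
  then show ?thesis unfolding closed_graph_def
    using closed_W
    by (simp only:) (intro closed_Int closed_Times closed_UNIV closed_Collect_eq continuous_intros)
qed

lemma locally_bounded: "locally_bounded (metric_proj W)"
  unfolding locally_bounded_def
proof
  fix f
  obtain w0 where w0: "w0 \<in> W" using nonempty by blast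
  have "norm w \<le> 2 * (norm f + 1) + norm w0" if "g \<in> ball f 1" "w \<in> metric_proj W g" for g w
  proof -
    have "norm (g - w) \<le> norm (g - w0)"
      using that w0 infdist_le[OF w0, of g] unfolding metric_proj_def by (simp add: dist_norm)
    moreover have "norm g \<le> norm f + 1"
      using that norm_triangle_sub[of g f] by (auto simp: dist_norm norm_minus_commute)
    ultimately show ?thesis
      using norm_triangle_ineq4[of g w0] norm_triangle_sub[of w g] by (simp add: norm_minus_commute)
  qed
  then have "bounded (\<Union>g\<in>ball f 1. metric_proj W g)" unfolding bounded_iff by blast
  then show "\<exists>B. open B \<and> f \<in> B \<and> bounded (\<Union>g\<in>B. metric_proj W g)"
    by (intro exI[of _ "ball f 1"]) simp
qed

end

lemma convex_metric_proj:
  assumes "convex W"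
  shows "convex (metric_proj W f)"
proof (cases "W = {}")
  case True
  then show ?thesis by (simp add: metric_proj_def)
next
  case False
  have "metric_proj W f = W \<inter> cball f (infdist f W)"
    using infdist_le[of _ W f] unfolding metric_proj_def
    by (auto simp: dist_norm intro: antisym)
  then show ?thesis using assms by (simp add: convex_Int)
qed

section \<open>A selector by strictly convex regularisation\<close>

text \<open>
  Nearest points for the given norm need not be unique. A strictly convex penalty $q$ singles one out:
  for every $\epsilon > 0$ the penalised distance has exactly one minimiser, and as $\epsilon \to 0$ only
  the $q$-smallest best approximant survives.
\<close>

locale regularised_approximation = boundedly_compact W
  for W :: "'y::real_normed_vector set" +
  fixes q :: "'y \<Rightarrow> real"
  assumes convex_W: "convex W"
    and q_cont: "continuous_on UNIV q"
    and q_nonneg: "0 \<le> q w"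
    and q_strict: "u \<in> W \<Longrightarrow> v \<in> W \<Longrightarrow> u \<noteq> v \<Longrightarrow> q ((1/2) *\<^sub>R (u + v)) < (q u + q v) / 2"
begin

definition penalty :: "real \<Rightarrow> 'y \<Rightarrow> 'y \<Rightarrow> real" where
  "penalty \<epsilon> f w = norm (f - w) + \<epsilon> * q w"

definition is_minimiser :: "real \<Rightarrow> 'y \<Rightarrow> 'y \<Rightarrow> bool" where
  "is_minimiser \<epsilon> f w \<longleftrightarrow> w \<in> W \<and> (\<forall>v\<in>W. penalty \<epsilon> f w \<le> penalty \<epsilon> f v)"

lemma midpoint_in: "convex S \<Longrightarrow> u \<in> S \<Longrightarrow> v \<in> S \<Longrightarrow> (1/2) *\<^sub>R (u + v) \<in> S" for S :: "'y set"
  unfolding convex_def by (simp add: scaleR_add_right)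

lemma q_tendsto: "x \<longlonglongrightarrow> l \<Longrightarrow> (\<lambda>k. q (x k)) \<longlonglongrightarrow> q l"
  using q_cont continuous_on_tendsto_compose[of UNIV q] by auto

lemma minimiser_unique:
  assumes "\<epsilon> > 0" "is_minimiser \<epsilon> f u" "is_minimiser \<epsilon> f v"
  shows "u = v"
proof (rule ccontr)
  assume "u \<noteq> v"
  have uv: "u \<in> W" "v \<in> W" using assms unfolding is_minimiser_def by auto
  define m where "m = (1/2) *\<^sub>R (u + v)"
  have "m \<in> W" unfolding m_def using midpoint_in convex_W uv by blast
  then have le: "penalty \<epsilon> f u \<le> penalty \<epsilon> f m" "penalty \<epsilon> f v \<le> penalty \<epsilon> f m"
    using assms unfolding is_minimiser_def by auto
  have "f - m = (1/2) *\<^sub>R ((f - u) + (f - v))"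
    unfolding m_def by (simp add: algebra_simps flip: scaleR_add_left)
  then have "norm (f - m) \<le> (norm (f - u) + norm (f - v)) / 2"
    using norm_triangle_ineq[of "f - u" "f - v"] by simp
  moreover have "\<epsilon> * q m < \<epsilon> * ((q u + q v) / 2)"
    using q_strict[OF uv \<open>u \<noteq> v\<close>] assms(1) unfolding m_def by simp
  ultimately have "penalty \<epsilon> f m < (penalty \<epsilon> f u + penalty \<epsilon> f v) / 2"
    unfolding penalty_def by (simp add: algebra_simps)
  then show False using le by simp
qed

lemma penalty_coercive:
  assumes "\<epsilon> > 0"
  shows "norm w \<le> penalty \<epsilon> f w + norm f"
proof -
  have "0 \<le> \<epsilon> * q w" using q_nonneg assms by simp
  then show ?thesis
    using norm_triangle_sub[of w f] unfolding penalty_def by (simp add: norm_minus_commute)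
qed

lemma minimiser_exists:
  assumes "\<epsilon> > 0"
  shows "\<exists>w. is_minimiser \<epsilon> f w"
proof -
  obtain w0 where w0: "w0 \<in> W" using nonempty by blast
  define K where "K = W \<inter> cball 0 (penalty \<epsilon> f w0 + norm f)"
  have "compact K" unfolding K_def by (rule compact_balls)
  moreover have "w0 \<in> K" unfolding K_def using w0 penalty_coercive[OF assms] by auto
  moreover have "continuous_on K (penalty \<epsilon> f)" unfolding penalty_def
    by (intro continuous_intros continuous_on_subset[OF q_cont]) auto
  ultimately obtain w where w: "w \<in> K" "\<And>v. v \<in> K \<Longrightarrow> penalty \<epsilon> f w \<le> penalty \<epsilon> f v"
    using continuous_attains_inf[of K] by blast
  have "penalty \<epsilon> f w \<le> penalty \<epsilon> f v" if "v \<in> W" for v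
  proof (cases "v \<in> K")
    case False
    then have "penalty \<epsilon> f w0 < penalty \<epsilon> f v"
      using that penalty_coercive[OF assms, of v f] unfolding K_def by auto
    then show ?thesis using w(2)[OF \<open>w0 \<in> K\<close>] by simp
  qed (use w in blast)
  then show ?thesis using w(1) unfolding is_minimiser_def K_def by auto
qed

definition minimiser :: "real \<Rightarrow> 'y \<Rightarrow> 'y" where
  "minimiser \<epsilon> f = (SOME w. is_minimiser \<epsilon> f w)"

lemma minimiser: "\<epsilon> > 0 \<Longrightarrow> is_minimiser \<epsilon> f (minimiser \<epsilon> f)"
  unfolding minimiser_def by (rule someI_ex) (rule minimiser_exists)

text \<open>
  The minimisers belonging to a convergent sequence of functions are bounded, and by continuity of the
  penalised distance each of their cluster points is the minimiser for the limit.
\<close>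

lemma continuous_minimiser:
  assumes "\<epsilon> > 0"
  shows "continuous_on UNIV (minimiser \<epsilon>)"
  unfolding continuous_on_sequentially
proof (intro allI ballI impI, elim conjE)
  fix f :: "nat \<Rightarrow> 'y" and f0 assume lim: "f \<longlonglongrightarrow> f0"
  let ?w = "\<lambda>k. minimiser \<epsilon> (f k)"
  have wW: "?w k \<in> W" and wmin: "v \<in> W \<Longrightarrow> penalty \<epsilon> (f k) (?w k) \<le> penalty \<epsilon> (f k) v" for k v
    using minimiser[OF assms, of "f k"] unfolding is_minimiser_def by auto
  obtain v0 where v0: "v0 \<in> W" using nonempty by blast
  obtain K where K: "\<And>k. norm (f k) \<le> K"
    using LIMSEQ_norm_bounded[OF lim] by blast
  have bdd: "norm (?w k) \<le> 2 * K + norm v0 + \<epsilon> * q v0" for k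
    using penalty_coercive[OF assms, of "?w k" "f k"] wmin[OF v0, of k] K[of k]
      norm_triangle_ineq4[of "f k" v0] unfolding penalty_def by simp
  have "?w \<longlonglongrightarrow> minimiser \<epsilon> f0"
  proof (rule tendsto_if_subsequences_tendsto)
    fix r :: "nat \<Rightarrow> nat" assume r: "strict_mono r"
    have "bounded (range (\<lambda>k. ?w (r k)))" unfolding bounded_iff using bdd by blast
    then obtain s l where s: "strict_mono s" "l \<in> W" "(\<lambda>k. ?w (r (s k))) \<longlonglongrightarrow> l"
      using bounded_subsequence[of "\<lambda>k. ?w (r k)"] wW by metis
    have fs: "(\<lambda>k. f (r (s k))) \<longlonglongrightarrow> f0"
      using LIMSEQ_subseq_LIMSEQ[OF LIMSEQ_subseq_LIMSEQ[OF lim r] s(1)] by (simp add: comp_def)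
    have "penalty \<epsilon> f0 l \<le> penalty \<epsilon> f0 v" if "v \<in> W" for v
    proof (rule LIMSEQ_le)
      show "(\<lambda>k. penalty \<epsilon> (f (r (s k))) (?w (r (s k)))) \<longlonglongrightarrow> penalty \<epsilon> f0 l"
        unfolding penalty_def by (intro tendsto_intros fs s(3) q_tendsto)
      show "(\<lambda>k. penalty \<epsilon> (f (r (s k))) v) \<longlonglongrightarrow> penalty \<epsilon> f0 v"
        unfolding penalty_def by (intro tendsto_intros fs)
    qed (use wmin that in blast)
    then have "is_minimiser \<epsilon> f0 l" using s(2) unfolding is_minimiser_def by blast
    then have "l = minimiser \<epsilon> f0" using minimiser_unique minimiser assms by blast
    then show "\<exists>s. strict_mono s \<and> (\<lambda>n. ?w (r (s n))) \<longlonglongrightarrow> minimiser \<epsilon> f0" using s by blast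
  qed
  then show "(minimiser \<epsilon> \<circ> f) \<longlonglongrightarrow> minimiser \<epsilon> f0" by (simp add: comp_def)
qed

definition selector :: "'y \<Rightarrow> 'y" where
  "selector f = (SOME w. w \<in> metric_proj W f \<and> (\<forall>v\<in>metric_proj W f. q w \<le> q v))"

lemma selector: "selector f \<in> metric_proj W f" "v \<in> metric_proj W f \<Longrightarrow> q (selector f) \<le> q v"
proof -
  have "\<exists>w. w \<in> metric_proj W f \<and> (\<forall>v\<in>metric_proj W f. q w \<le> q v)"
    using continuous_attains_inf[OF compact_metric_proj metric_proj_nonempty, of f q]
      continuous_on_subset[OF q_cont] by blast
  from someI_ex[OF this] show "selector f \<in> metric_proj W f"
    "v \<in> metric_proj W f \<Longrightarrow> q (selector f) \<le> q v"
    unfolding selector_def by auto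
qed

lemma selector_unique:
  assumes "w \<in> metric_proj W f" "q w \<le> q (selector f)"
  shows "w = selector f"
proof (rule ccontr)
  assume ne: "w \<noteq> selector f"
  have "(1/2) *\<^sub>R (w + selector f) \<in> metric_proj W f"
    using midpoint_in convex_metric_proj[OF convex_W] assms(1) selector(1) by blast
  then have "q (selector f) \<le> q ((1/2) *\<^sub>R (w + selector f))" by (rule selector(2))
  also have "\<dots> < (q w + q (selector f)) / 2"
    using q_strict ne assms(1) selector(1) unfolding metric_proj_def by blast
  finally show False using assms(2) by simp
qed

text \<open>
  Comparison with the selector shows that the minimisers are nearly best approximants whose penalty is
  at most that of the selector. Cluster points are thus best approximants with this property, and the
  selector is the only one.
\<close>

lemma minimiser_tendsto_selector: "(\<lambda>k. minimiser (1 / Suc k) f) \<longlonglongrightarrow> selector f"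
proof (rule tendsto_if_subsequences_tendsto)
  fix r :: "nat \<Rightarrow> nat" assume r: "strict_mono r"
  let ?w = "\<lambda>k. minimiser (1 / Suc k) f"
  let ?d = "infdist f W"
  have sel: "selector f \<in> W" "norm (f - selector f) = ?d"
    using selector(1) unfolding metric_proj_def by auto
  have wW: "?w k \<in> W" and "penalty (1 / Suc k) f (?w k) \<le> penalty (1 / Suc k) f (selector f)" for k
    using minimiser[of "1 / Suc k" f] sel(1) unfolding is_minimiser_def by auto
  then have le: "norm (f - ?w k) + 1 / Suc k * q (?w k) \<le> ?d + 1 / Suc k * q (selector f)" for k
    using sel(2) unfolding penalty_def by metis
  have ge: "?d \<le> norm (f - ?w k)" for k using infdist_le[OF wW] by (simp add: dist_norm)
  \<comment> \<open>as no point is nearer than the selector, the minimiser can only win through a smaller penalty\<close>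
  have qw: "q (?w k) \<le> q (selector f)" for k
  proof -
    have "1 / Suc k * q (?w k) \<le> 1 / Suc k * q (selector f)" using le[of k] ge[of k] by linarith
    then show ?thesis by (rule mult_left_le_imp_le) simp
  qed
  have near: "norm (f - ?w k) \<le> ?d + 1 / Suc k * q (selector f)" for k
  proof -
    have "0 \<le> 1 / Suc k * q (?w k)" using q_nonneg by simp
    then show ?thesis using le[of k] by linarith
  qed
  have "(\<lambda>k. 1 / Suc k * q (selector f)) \<longlonglongrightarrow> 0"
    using tendsto_mult_right[OF lim_1_over_Suc] by fastforce
  then have \<delta>: "(\<lambda>k. 1 / Suc (r k) * q (selector f)) \<longlonglongrightarrow> 0"
    using LIMSEQ_subseq_LIMSEQ[OF _ r] by (fastforce simp: comp_def)
  obtain s l where s: "strict_mono s" "l \<in> metric_proj W f" "(\<lambda>k. ?w (r (s k))) \<longlonglongrightarrow> l"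
    by (rule near_best_subsequence[of "\<lambda>k. ?w (r k)" "\<lambda>_. f" f, OF wW tendsto_const \<delta> near])
  have "q l \<le> q (selector f)" by (rule LIMSEQ_le_const2[OF q_tendsto[OF s(3)]]) (use qw in blast)
  then have "l = selector f" using selector_unique s(2) by blast
  then show "\<exists>s. strict_mono s \<and> (\<lambda>n. ?w (r (s n))) \<longlonglongrightarrow> selector f" using s by blast
qed

lemma first_baire_selector: "first_baire_class_into W selector"
  unfolding first_baire_class_into_def
  by (intro exI[of _ "\<lambda>k. minimiser (1 / Suc k)"] conjI allI continuous_minimiser
      minimiser_tendsto_selector)
    (use minimiser[unfolded is_minimiser_def] in \<open>auto simp: image_subset_iff\<close>)

end

section \<open>Points of discontinuity\<close>

text \<open>
  The points all of whose neighbourhoods contain two points with values at least $1/(k+1)$ apart form a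
  closed set, and a discontinuity is a point in one of these sets.
\<close>

lemma fsigma_discontinuities:
  fixes J :: "'x::t2_space \<Rightarrow> 'y::metric_space"
  shows "fsigma_in euclidean {x. \<not> isCont J x}"
proof -
  define D where "D k = {x. \<forall>U. open U \<and> x \<in> U \<longrightarrow> (\<exists>y\<in>U. \<exists>z\<in>U. 1 / real (Suc k) \<le> dist (J y) (J z))}" for k
  have "open (- D k)" for k
  proof (subst open_subopen, intro ballI)
    fix x assume "x \<in> - D k"
    then obtain U where "open U" "x \<in> U" "U \<subseteq> - D k" unfolding D_def by blast
    then show "\<exists>T. open T \<and> x \<in> T \<and> T \<subseteq> - D k" by blast
  qed
  then have cl: "closed (D k)" for k by (simp add: closed_def)
  have "{x. \<not> isCont J x} = (\<Union>k. D k)"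
  proof (intro equalityI subsetI)
    fix x assume "x \<in> {x. \<not> isCont J x}"
    then obtain \<epsilon> where \<epsilon>: "\<epsilon> > 0" "\<not> (\<forall>\<^sub>F y in at x. dist (J y) (J x) < \<epsilon>)"
      unfolding isCont_def tendsto_iff by blast
    obtain k where k: "1 / real (Suc k) < \<epsilon>" using \<epsilon>(1) nat_approx_posE by blast
    have "x \<in> D k" unfolding D_def
    proof (intro CollectI allI impI)
      fix U assume U: "open U \<and> x \<in> U"
      then obtain y where "y \<in> U" "\<epsilon> \<le> dist (J y) (J x)"
        using \<epsilon>(2) unfolding eventually_at_topological by (meson not_less)
      then show "\<exists>y\<in>U. \<exists>z\<in>U. 1 / real (Suc k) \<le> dist (J y) (J z)"
        using U k by (meson less_imp_le order.trans)
    qed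
    then show "x \<in> (\<Union>k. D k)" by blast
  next
    fix x assume "x \<in> (\<Union>k. D k)"
    then obtain k where k: "x \<in> D k" by blast
    show "x \<in> {x. \<not> isCont J x}"
    proof (intro CollectI notI)
      assume "isCont J x"
      then have "(J \<longlongrightarrow> J x) (at x)" unfolding isCont_def .
      then have "\<forall>\<^sub>F y in at x. dist (J y) (J x) < 1 / Suc k / 2"
        by (rule tendstoD) simp
      then obtain U where U: "open U" "x \<in> U" "\<And>y. y \<in> U \<Longrightarrow> y \<noteq> x \<Longrightarrow> dist (J y) (J x) < 1 / Suc k / 2"
        unfolding eventually_at_topological by blast
      obtain y z where "y \<in> U" "z \<in> U" "1 / real (Suc k) \<le> dist (J y) (J z)"
        using k U unfolding D_def by blast
      moreover have "dist (J y) (J x) < 1 / Suc k / 2" if "y \<in> U" for y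
        using U(3)[OF that] by (cases "y = x") auto
      then have "dist (J y) (J x) < 1 / Suc k / 2" "dist (J z) (J x) < 1 / Suc k / 2"
        using \<open>y \<in> U\<close> \<open>z \<in> U\<close> by blast+
      ultimately show False using dist_triangle2[of "J y" "J z" "J x"] by linarith
    qed
  qed
  moreover have "fsigma_in euclidean (\<Union>k. D k)"
    by (rule fsigma_in_Union) (auto intro: closed_imp_fsigma_in simp: cl)
  ultimately show ?thesis by simp
qed

text \<open>
  Let $A_{m,n}$ be the closed set on which all $F_i$ with $i \ge n$ are within $1/(m+1)$ of $F_n$. In the
  interior of $A_{m,n}$ the limit is uniformly close to a continuous function and so oscillates little,
  and for fixed $m$ the sets $A_{m,n}$ cover the space. A discontinuity therefore lies in some
  $A_{m,n} \setminus \mathrm{int}\,A_{m,n}$, which is nowhere dense.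
\<close>

lemma first_category_discontinuities:
  fixes J :: "'x::t2_space \<Rightarrow> 'y::metric_space"
  assumes cont: "\<And>k. continuous_on UNIV (F k)" and lim: "\<And>x. (\<lambda>k. F k x) \<longlonglongrightarrow> J x"
  shows "first_category {x. \<not> isCont J x}"
proof -
  define A where "A m n = {x. \<forall>i\<ge>n. dist (F i x) (F n x) \<le> 1 / real (Suc m)}" for m n
  have clA: "closed (A m n)" for m n
  proof -
    have "A m n = (\<Inter>i\<in>{n..}. {x. dist (F i x) (F n x) \<le> 1 / real (Suc m)})"
      unfolding A_def by auto
    then show ?thesis using cont
      by (auto intro!: closed_INT closed_Collect_le continuous_intros)
  qed
  define B where "B j = (case prod_decode j of (m, n) \<Rightarrow> A m n - interior (A m n))" for j
  have nowhere_dense: "interior (closure (B j)) = {}" for j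
  proof -
    obtain m n where j: "prod_decode j = (m, n)" by fastforce
    have "closed (B j)" unfolding B_def j using clA by (simp add: closed_Diff)
    moreover have "interior (B j) \<subseteq> interior (A m n)" "interior (B j) \<subseteq> - interior (A m n)"
      unfolding B_def j using interior_mono[of "A m n - interior (A m n)" "A m n"]
        interior_subset[of "A m n - interior (A m n)"] by auto
    ultimately show ?thesis by auto
  qed
  have cover: "isCont J x" if "x \<notin> (\<Union>j. B j)" for x
    unfolding isCont_def tendsto_iff
  proof (intro allI impI)
    fix \<epsilon> :: real assume "\<epsilon> > 0"
    then obtain m where m: "1 / real (Suc m) < \<epsilon> / 3" using nat_approx_posE[of "\<epsilon> / 3"] by auto
    obtain n where n: "\<And>i j. i \<ge> n \<Longrightarrow> j \<ge> n \<Longrightarrow> dist (F i x) (F j x) < 1 / Suc m"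
      using metric_CauchyD[OF LIMSEQ_imp_Cauchy[OF lim[of x]], of "1 / Suc m"] by auto
    have "x \<in> A m n" unfolding A_def using n less_imp_le by blast
    moreover have "x \<notin> B (prod_encode (m, n))" using that by blast
    ultimately have int: "x \<in> interior (A m n)" unfolding B_def by auto
    have J: "dist (J y) (F n y) \<le> 1 / Suc m" if "y \<in> A m n" for y
    proof (rule LIMSEQ_le_const2)
      show "(\<lambda>i. dist (F i y) (F n y)) \<longlonglongrightarrow> dist (J y) (F n y)" by (intro tendsto_intros lim)
      show "\<exists>N. \<forall>i\<ge>N. dist (F i y) (F n y) \<le> 1 / Suc m" using that unfolding A_def by blast
    qed
    have "(F n \<longlongrightarrow> F n x) (at x)" using cont[of n] by (simp add: continuous_on_def)
    then have "\<forall>\<^sub>F y in at x. dist (F n y) (F n x) < \<epsilon> / 3" by (rule tendstoD) (use \<open>\<epsilon> > 0\<close> in simp)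
    moreover have "\<forall>\<^sub>F y in at x. y \<in> A m n"
      unfolding eventually_at_topological using int interior_subset open_interior by blast
    ultimately show "\<forall>\<^sub>F y in at x. dist (J y) (J x) < \<epsilon>"
    proof eventually_elim
      case (elim y)
      have "x \<in> A m n" using int interior_subset by blast
      then have "dist (J x) (F n x) \<le> 1 / Suc m" "dist (J y) (F n y) \<le> 1 / Suc m"
        using J elim by auto
      then show ?case using elim m
          dist_triangle[of "J y" "J x" "F n y"] dist_triangle[of "F n y" "J x" "F n x"]
        by (simp add: dist_commute)
    qed
  qed
  let ?S = "{x. \<not> isCont J x}"
  have "?S = (\<Union>j. ?S \<inter> B j)" using cover by blast
  moreover have "interior (closure (?S \<inter> B j)) = {}" for j
    using interior_mono[OF closure_mono[of "?S \<inter> B j" "B j"]] nowhere_dense by blast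
  ultimately show ?thesis unfolding first_category_def by (intro exI[of _ "\<lambda>j. ?S \<inter> B j"]) blast
qed

section \<open>Spaces of bounded continuous functions\<close>

lemma bounded_linear_eval: "bounded_linear (\<lambda>f :: 'a::topological_space \<Rightarrow>\<^sub>C real. f t)"
proof (rule bounded_linear_intro[where K = 1])
  show "norm (apply_bcontfun f t) \<le> norm f * 1" for f :: "'a \<Rightarrow>\<^sub>C real"
    using norm_bounded[of f t] by simp
qed simp_all

text \<open>
  The weak topology is coarser than the norm topology, so norm-compact sets are weakly compact.
  Evaluations at points are bounded functionals that separate functions; hence the weak topology is
  Hausdorff and its compact sets are closed.
\<close>

lemma closedin_weak_compact:
  fixes K :: "('a::topological_space \<Rightarrow>\<^sub>C real) set"
  assumes "compact K"
  shows "closedin weak_topology K"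
proof (rule compactin_imp_closedin)
  let ?S = "{\<phi> -` U |\<phi> U. bounded_linear (\<phi> :: ('a \<Rightarrow>\<^sub>C real) \<Rightarrow> real) \<and> open U}"
  have top: "topspace (weak_topology :: ('a \<Rightarrow>\<^sub>C real) topology) = UNIV"
  proof -
    have "(\<lambda>_. 0 :: real) -` UNIV \<in> ?S" using bounded_linear_zero open_UNIV by blast
    then have "UNIV \<in> ?S" by simp
    then show ?thesis unfolding weak_topology_def topology_generated_by_topspace by blast
  qed
  show "Hausdorff_space (weak_topology :: ('a \<Rightarrow>\<^sub>C real) topology)"
    unfolding Hausdorff_space_def
  proof (intro allI impI, elim conjE)
    fix f g :: "'a \<Rightarrow>\<^sub>C real" assume "f \<noteq> g"
    then obtain t where "f t \<noteq> g t" using bcontfun_eqI by blast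
    then obtain U V where UV: "open U" "open V" "f t \<in> U" "g t \<in> V" "U \<inter> V = {}"
      using hausdorff by metis
    let ?ev = "\<lambda>h :: 'a \<Rightarrow>\<^sub>C real. h t"
    have "openin weak_topology (?ev -` U)" "openin weak_topology (?ev -` V)"
      unfolding weak_topology_def using UV bounded_linear_eval by (blast intro: topology_generated_by_Basis)+
    moreover have "disjnt (?ev -` U) (?ev -` V)" using UV(5) by (auto simp: disjnt_def)
    ultimately show "\<exists>U V. openin weak_topology U \<and> openin weak_topology V \<and> f \<in> U \<and> g \<in> V \<and> disjnt U V"
      using UV by blast
  qed
  have "continuous_map euclidean weak_topology (\<lambda>f :: 'a \<Rightarrow>\<^sub>C real. f)"
    unfolding weak_topology_def
  proof (rule continuous_on_generated_topo)
    fix S assume "S \<in> ?S"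
    then show "openin euclidean ((\<lambda>f. f) -` S \<inter> topspace euclidean)"
      by (auto intro: open_vimage simp: linear_continuous_on)
  next
    show "(\<lambda>f. f) ` topspace euclidean \<subseteq> \<Union> ?S"
      using top unfolding weak_topology_def topology_generated_by_topspace by simp
  qed
  moreover have "compactin euclidean K" using assms by simp
  ultimately show "compactin weak_topology K" using image_compactin by fastforce
qed

lemma complete_bcontfun: "uniform_space_class.complete (UNIV :: ('b::topological_space \<Rightarrow>\<^sub>C real) set)"
  unfolding metric_space_class.complete_def
proof (intro allI impI, elim conjE)
  fix f :: "nat \<Rightarrow> 'b \<Rightarrow>\<^sub>C real" assume "Cauchy f"
  obtain g where "uniform_limit UNIV f g sequentially"
    using uniformly_convergent_eq_cauchy[of "\<lambda>_. True" f] \<open>Cauchy f\<close>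
    unfolding Cauchy_def uniform_limit_sequentially_iff
    by (metis dist_fun_lt_imp_dist_val_lt)
  then show "\<exists>l\<in>UNIV. f \<longlonglongrightarrow> l"
    by (metis UNIV_I sequentially_bot uniform_limit_bcontfunE)
qed

text \<open>
  Adding one generator $b$ to $B$ creates at most a line of functions that vanish on the old set $T$,
  because the $b$-coefficient of such a function determines it. One more point kills this line.
\<close>

lemma finite_separating_set:
  fixes B :: "('a::topological_space \<Rightarrow>\<^sub>C real) set"
  assumes "finite B"
  shows "\<exists>T. finite T \<and> (\<forall>w\<in>span B. (\<forall>t\<in>T. apply_bcontfun w t = 0) \<longrightarrow> w = 0)"
  using assms
proof induction
  case empty
  then show ?case by auto
next
  case (insert b B)
  then obtain T where T: "finite T" "\<And>w. w \<in> span B \<Longrightarrow> (\<forall>t\<in>T. apply_bcontfun w t = 0) \<Longrightarrow> w = 0" by blast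
  show ?case
  proof (cases "\<exists>w\<in>span (insert b B). (\<forall>t\<in>T. apply_bcontfun w t = 0) \<and> w \<noteq> 0")
    case False
    then show ?thesis using T(1) by blast
  next
    case True
    then obtain w0 where w0: "w0 \<in> span (insert b B)" "\<forall>t\<in>T. apply_bcontfun w0 t = 0" "w0 \<noteq> 0" by blast
    obtain t0 where t0: "w0 t0 \<noteq> 0" using w0(3) bcontfun_eqI by (metis zero_bcontfun.rep_eq)
    obtain c0 where c0: "w0 - c0 *\<^sub>R b \<in> span B" using w0(1) span_breakdown_eq by blast
    have "c0 \<noteq> 0" using c0 T(2)[of w0] w0 by auto
    have "w = 0" if w: "w \<in> span (insert b B)" "\<forall>t\<in>insert t0 T. apply_bcontfun w t = 0" for w
    proof -
      obtain c where c: "w - c *\<^sub>R b \<in> span B" using w(1) span_breakdown_eq by blast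
      have "(w - c *\<^sub>R b) - (c / c0) *\<^sub>R (w0 - c0 *\<^sub>R b) \<in> span B"
        by (rule span_diff[OF c span_scale[OF c0]])
      also have "(w - c *\<^sub>R b) - (c / c0) *\<^sub>R (w0 - c0 *\<^sub>R b) = w - (c / c0) *\<^sub>R w0"
        using \<open>c0 \<noteq> 0\<close> by (simp add: algebra_simps)
      finally have "w - (c / c0) *\<^sub>R w0 = 0" by (rule T(2)) (use w w0 in simp)
      then have eq: "w = (c / c0) *\<^sub>R w0" by simp
      then have "c / c0 * w0 t0 = 0" using w(2) by (metis insertI1 real_scaleR_def scaleR_bcontfun.rep_eq)
      then show ?thesis using eq t0 by simp
    qed
    then show ?thesis using T(1) by (intro exI[of _ "insert t0 T"]) blast
  qed
qed

text \<open>
  If the finite set $T$ separates the span, then $w \mapsto \sum_{t \in T} w(t)^2$ is the square of a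
  Euclidean norm there, and the parallelogram law makes it strictly convex.
\<close>

lemma regularised_approximation_span:
  fixes B :: "('a::topological_space \<Rightarrow>\<^sub>C real) set"
  assumes "finite B"
  shows "\<exists>q. regularised_approximation (span B) q"
proof -
  obtain T where T: "finite T" "\<And>w. w \<in> span B \<Longrightarrow> (\<forall>t\<in>T. apply_bcontfun w t = 0) \<Longrightarrow> w = 0"
    using finite_separating_set[OF assms] by blast
  define q where "q w = (\<Sum>t\<in>T. (w t)\<^sup>2)" for w :: "'a \<Rightarrow>\<^sub>C real"
  have "regularised_approximation (span B) q"
  proof
    show "compact (span B \<inter> cball 0 r)" for r using compact_span_cball[OF assms] .
    show "span B \<noteq> {}" using span_zero by blast
    show "convex (span B)" by (simp add: subspace_imp_convex)
    have "continuous_on UNIV (\<lambda>w :: 'a \<Rightarrow>\<^sub>C real. w t)" for t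
      by (intro linear_continuous_on bounded_linear_eval)
    then show "continuous_on UNIV q" unfolding q_def by (intro continuous_intros)
    show "0 \<le> q w" for w unfolding q_def by (simp add: sum_nonneg)
    fix u v assume uv: "u \<in> span B" "v \<in> span B" "u \<noteq> v"
    then obtain t where t: "t \<in> T" "(u - v) t \<noteq> 0" using T(2)[of "u - v"] span_diff by fastforce
    have "(q u + q v) / 2 - q ((1/2) *\<^sub>R (u + v)) = (\<Sum>t\<in>T. ((u t - v t) / 2)\<^sup>2)"
      unfolding q_def
      by (simp add: sum_divide_distrib flip: sum.distrib sum_subtractf)
        (intro sum.cong refl, simp add: power2_eq_square field_simps)
    moreover have "(\<Sum>t\<in>T. ((u t - v t) / 2)\<^sup>2) > 0" using T(1) t by (intro sum_pos2[of _ t]) auto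
    ultimately show "q ((1/2) *\<^sub>R (u + v)) < (q u + q v) / 2" by linarith
  qed
  then show ?thesis by blast
qed

section \<open>Combinatorics of the gasket\<close>

text \<open>
  The geometry of the triangle enters through \<open>F_meet\<close>, according to which two first-level cells
  share only the image of a vertex; everything about the intersection of deeper cells follows from it.
\<close>

locale gasket =
  fixes p :: "3 \<Rightarrow> real^2" and SG :: "(real^2) set" and e :: "'a::topological_space \<Rightarrow> real^2"
  assumes equilateral: "equilateral p"
    and SG_nonempty: "SG \<noteq> {}"
    and compact_SG: "compact SG"
    and self_similar: "SG = (\<Union>i. contraction p i ` SG)"
    and homeo: "homeomorphism UNIV SG e (inv e)"
begin

abbreviation F :: "3 \<Rightarrow> 'a \<Rightarrow> 'a" where "F \<equiv> cell_map p e"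
abbreviation word :: "3 list \<Rightarrow> 'a \<Rightarrow> 'a" where "word \<equiv> word_map p e"

definition v :: "3 \<Rightarrow> 'a" where "v i = inv e (p i)"

lemma e_in_SG: "e t \<in> SG"
  using homeo unfolding homeomorphism_def by blast

lemma e_inv: "x \<in> SG \<Longrightarrow> e (inv e x) = x"
  using homeo unfolding homeomorphism_def by blast

lemma e_inject: "e x = e y \<longleftrightarrow> x = y"
  using homeo unfolding homeomorphism_def by (metis UNIV_I)

lemma contraction_in_SG: "x \<in> SG \<Longrightarrow> contraction p i x \<in> SG"
  using self_similar by blast

lemma e_F: "e (F i t) = (1/2) *\<^sub>R (e t + p i)"
  using e_inv[OF contraction_in_SG[OF e_in_SG]] unfolding cell_map_def contraction_def by simp

lemma SG_cases:
  assumes "x \<in> SG"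
  obtains i y where "y \<in> SG" "x = (1/2) *\<^sub>R (y + p i)"
  using assms self_similar unfolding contraction_def by blast

text \<open>
  The barycentric coordinate belonging to $p_i$, written with inner products: for the side length $s$
  one has $(p_j - p_i) \cdot \sum_k (p_i - p_k) = -3s^2/2$ whenever $j \ne i$.
\<close>

lemma barycentric_coordinate:
  obtains b :: "real^2 \<Rightarrow> real"
  where "continuous_on UNIV b" "\<And>x y. b ((1/2) *\<^sub>R (x + y)) = (b x + b y) / 2"
    "\<And>j. b (p j) = (if j = i then 1 else 0)"
proof -
  obtain s where s: "s > 0" "\<And>i j. i \<noteq> j \<Longrightarrow> dist (p i) (p j) = s"
    using equilateral unfolding equilateral_def by blast
  define b where "b x = 1 + 2 / (3 * s\<^sup>2) * ((x - p i) \<bullet> (\<Sum>k\<in>UNIV. p i - p k))" for x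
  have sq: "(norm (p j - p k))\<^sup>2 = (if j = k then 0 else s\<^sup>2)" for j k
    using s(2)[of j k] by (simp add: dist_norm)
  have inner: "(p j - p i) \<bullet> (p i - p k) =
    ((norm (p j - p k))\<^sup>2 - (norm (p j - p i))\<^sup>2 - (norm (p i - p k))\<^sup>2) / 2" for j k
    by (simp add: power2_norm_eq_inner inner_diff inner_commute algebra_simps)
  have "b (p j) = (if j = i then 1 else 0)" for j
  proof (cases "j = i")
    case False
    have "(p j - p i) \<bullet> (\<Sum>k\<in>UNIV. p i - p k) = (\<Sum>k\<in>UNIV. (p j - p i) \<bullet> (p i - p k))"
      by (rule inner_sum_right)
    also have "\<dots> = - (3 * s\<^sup>2 / 2)"
      unfolding inner sq sum_3
      using False exhaust_3[of i] exhaust_3[of j] by auto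
    finally show ?thesis unfolding b_def using s(1) False by (simp add: field_simps)
  qed (simp add: b_def)
  moreover have "continuous_on UNIV b" unfolding b_def by (intro continuous_intros)
  moreover have "b ((1/2) *\<^sub>R (x + y)) = (b x + b y) / 2" for x y
  proof -
    have "(1/2) *\<^sub>R (x + y) - p i = (1/2) *\<^sub>R ((x - p i) + (y - p i))"
      by (simp add: vec_eq_iff field_simps)
    then show ?thesis unfolding b_def by (simp add: inner_add_left algebra_simps)
  qed
  ultimately show ?thesis by (intro that)
qed

text \<open>
  A point of the gasket is a midpoint of some $p_k$ and another point of the gasket. Applied at a point
  where the coordinate is extremal this confines it to $[0,1]$; applied at the point farthest
  from $p_i$ among those with coordinate $1$ it shows that $p_i$ is the only such point.
\<close>

lemma vertex_coordinate:
  obtains b :: "real^2 \<Rightarrow> real"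
  where "\<And>x y. b ((1/2) *\<^sub>R (x + y)) = (b x + b y) / 2" "\<And>j. b (p j) = (if j = i then 1 else 0)"
    "\<And>x. x \<in> SG \<Longrightarrow> 0 \<le> b x \<and> b x \<le> 1" "\<And>x. x \<in> SG \<Longrightarrow> b x = 1 \<Longrightarrow> x = p i"
proof -
  obtain b :: "real^2 \<Rightarrow> real" where b: "continuous_on UNIV b" "\<And>x y. b ((1/2) *\<^sub>R (x + y)) = (b x + b y) / 2"
    "\<And>j. b (p j) = (if j = i then 1 else 0)"
    by (rule barycentric_coordinate[of i]) blast
  have cont: "continuous_on S b" for S using b(1) continuous_on_subset by blast
  obtain x0 where x0: "x0 \<in> SG" "\<And>x. x \<in> SG \<Longrightarrow> b x0 \<le> b x"
    using continuous_attains_inf[OF compact_SG SG_nonempty cont] by blast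
  obtain x1 where x1: "x1 \<in> SG" "\<And>x. x \<in> SG \<Longrightarrow> b x \<le> b x1"
    using continuous_attains_sup[OF compact_SG SG_nonempty cont] by blast
  have "0 \<le> b x0"
  proof (rule SG_cases[OF x0(1)])
    fix k y assume "y \<in> SG" "x0 = (1/2) *\<^sub>R (y + p k)"
    then show ?thesis using b(2)[of y "p k"] b(3)[of k] x0(2)[of y] by (simp split: if_splits)
  qed
  moreover have "b x1 \<le> 1"
  proof (rule SG_cases[OF x1(1)])
    fix k y assume "y \<in> SG" "x1 = (1/2) *\<^sub>R (y + p k)"
    then show ?thesis using b(2)[of y "p k"] b(3)[of k] x1(2)[of y] by (simp split: if_splits)
  qed
  ultimately have bounds: "0 \<le> b x \<and> b x \<le> 1" if "x \<in> SG" for x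
    using x0(2)[OF that] x1(2)[OF that] by linarith
  have top: "x = p i" if x: "x \<in> SG" "b x = 1" for x
  proof -
    have "compact (SG \<inter> {x. b x = 1})"
      by (intro compact_Int_closed compact_SG closed_Collect_eq b(1) continuous_intros)
    moreover have "SG \<inter> {x. b x = 1} \<noteq> {}" using x by blast
    ultimately obtain z where z: "z \<in> SG" "b z = 1"
      "\<And>x. x \<in> SG \<Longrightarrow> b x = 1 \<Longrightarrow> dist x (p i) \<le> dist z (p i)"
      using continuous_attains_sup[OF _ _ continuous_on_dist[OF continuous_on_id continuous_on_const], of "SG \<inter> {x. b x = 1}" "p i"]
      by auto
    obtain k y where y: "y \<in> SG" "z = (1/2) *\<^sub>R (y + p k)" by (rule SG_cases[OF z(1)])
    have "k = i \<and> b y = 1"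
      using b(2)[of y "p k"] b(3)[of k] y z(2) bounds[OF y(1)] by (auto split: if_splits)
    moreover have "z - p i = (1/2) *\<^sub>R (y - p i)" if "k = i"
      unfolding y(2) that by (simp add: vec_eq_iff field_simps)
    ultimately have "dist z (p i) = dist y (p i) / 2" "dist y (p i) \<le> dist z (p i)"
      using z(3)[OF y(1)] by (auto simp: dist_norm)
    then have "dist z (p i) = 0" using zero_le_dist[of y "p i"] by linarith
    then show ?thesis using z(3)[OF x] by simp
  qed
  show ?thesis by (rule that[OF b(2,3) bounds top])
qed

text \<open>
  The contraction towards $p_i$ halves the distance to $p_i$, so a point of the gasket nearest to $p_i$
  must be $p_i$.
\<close>

lemma p_in_SG: "p i \<in> SG"
proof -
  obtain z where z: "z \<in> SG" "\<And>x. x \<in> SG \<Longrightarrow> dist z (p i) \<le> dist x (p i)"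
    using continuous_attains_inf[OF compact_SG SG_nonempty continuous_on_dist[OF continuous_on_id continuous_on_const], of "p i"]
    by (auto simp: dist_commute)
  have "contraction p i z - p i = (1/2) *\<^sub>R (z - p i)"
    unfolding contraction_def by (simp add: vec_eq_iff field_simps)
  then have "dist (contraction p i z) (p i) = dist z (p i) / 2" by (simp add: dist_norm)
  then have "dist z (p i) = 0" using z(2)[OF contraction_in_SG[OF z(1)], of i] zero_le_dist[of z "p i"] by linarith
  then show ?thesis using z(1) by simp
qed

lemma e_v: "e (v i) = p i"
  unfolding v_def using e_inv p_in_SG by blast

lemma v_inject: "v i = v j \<longleftrightarrow> i = j"
proof
  assume "v i = v j"
  then have "dist (p i) (p j) = 0" using e_v by (metis dist_self)
  then show "i = j" using equilateral unfolding equilateral_def by force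
qed simp

lemma boundary_vertices: "boundary_vertices p e = range v"
  unfolding boundary_vertices_def by (auto simp: e_inject simp flip: e_v)

lemma F_v: "F i (v j) = F j (v i)"
  by (simp add: e_F e_v add.commute flip: e_inject)

lemma F_v_same: "F i (v i) = v i"
  by (simp add: e_F e_v flip: e_inject scaleR_2)

lemma F_inject: "F i x = F i y \<longleftrightarrow> x = y"
  by (simp add: e_F flip: e_inject)

lemma F_cover:
  obtains i s where "t = F i s"
proof -
  obtain i y where "y \<in> SG" "e t = (1/2) *\<^sub>R (y + p i)" by (rule SG_cases[OF e_in_SG[of t]])
  then have "e t = e (F i (inv e y))" by (simp add: e_F e_inv)
  then show ?thesis using that e_inject by blast
qed

text \<open>
  The coordinate of $p_i$ is at least $1/2$ on the cell $i$ and at most $1/2$ on any other cell.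
  A common point has coordinate exactly $1/2$, which forces $y$ to have coordinate $1$.
\<close>

lemma F_meet:
  assumes "F i x = F j y" "i \<noteq> j"
  shows "y = v i"
proof -
  obtain b :: "real^2 \<Rightarrow> real" where b: "\<And>x y. b ((1/2) *\<^sub>R (x + y)) = (b x + b y) / 2"
    "\<And>j. b (p j) = (if j = i then 1 else 0)"
    "\<And>x. x \<in> SG \<Longrightarrow> 0 \<le> b x \<and> b x \<le> 1" "\<And>x. x \<in> SG \<Longrightarrow> b x = 1 \<Longrightarrow> x = p i"
    by (rule vertex_coordinate[of i]) blast
  have "(b (e x) + 1) / 2 = b (e y) / 2"
    using arg_cong[OF assms(1), of "\<lambda>t. b (e t)"] assms(2) by (simp add: e_F b(1,2))
  then have "b (e y) = 1" using b(3)[OF e_in_SG[of x]] b(3)[OF e_in_SG[of y]] by simp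
  then have "e y = e (v i)" using b(4)[OF e_in_SG] e_v by simp
  then show ?thesis using e_inject by blast
qed

lemma F_eq_v: "F i x = v j \<Longrightarrow> i = j \<and> x = v j"
  using F_meet[of i x j "v j"] F_v_same F_inject v_inject by metis

lemma word_Nil [simp]: "word [] x = x"
  and word_Cons [simp]: "word (i # w) x = F i (word w x)"
  and word_append: "word (w @ u) x = word w (word u x)"
  by (simp_all add: word_map_def)

lemma word_inject: "word w x = word w y \<longleftrightarrow> x = y"
  by (induction w) (auto simp: F_inject)

lemma word_eq_v: "word w x = v j \<Longrightarrow> x = v j"
  by (induction w) (auto dest: F_eq_v)

lemma word_replicate_v: "word (replicate n i) (v i) = v i"
  by (induction n) (auto simp: F_v_same)

lemma word_cover: "\<exists>w x. length w = m \<and> t = word w x"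
proof (induction m arbitrary: t)
  case (Suc m)
  obtain i s where "t = F i s" by (rule F_cover)
  then show ?case using Suc[of s] by (metis length_Cons word_Cons)
qed auto

text \<open>
  After cancelling the common prefix of the two words, the two points lie in different first-level
  cells, whose only common point is the image of a vertex; a vertex can only come from a vertex.
\<close>

lemma word_meet:
  assumes "length w = length w'" "word w x = word w' y" "w \<noteq> w'"
  shows "x \<in> range v"
  using assms
proof (induction w w' rule: list_induct2)
  case (Cons i w j w')
  show ?case
  proof (cases "i = j")
    case True
    then show ?thesis using Cons by (simp add: F_inject)
  next
    case False
    then have "word w x = v j" using Cons.prems F_meet[of j "word w' y" i "word w x"] by simp
    then show ?thesis using word_eq_v by blast
  qed
qed simp

text \<open>
  Two cells of the same level share at most one point, so every edge of the graph $\sim_m$ belongs to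
  exactly one cell.
\<close>

lemma word_meet_unique:
  assumes "length w = length w'" "word w x = word w' y" "word w x' = word w' y'" "w \<noteq> w'"
  shows "x = x'"
  using assms
proof (induction w w' rule: list_induct2)
  case (Cons i w j w')
  show ?case
  proof (cases "i = j")
    case True
    then show ?thesis using Cons by (simp add: F_inject)
  next
    case False
    then have "word w x = v j" "word w x' = v j"
      using Cons.prems F_meet[of j "word w' y" i "word w x"] F_meet[of j "word w' y'" i "word w x'"]
      by simp_all
    then show ?thesis using word_eq_v by metis
  qed
qed simp

lemma dist_word: "dist (e (word w x)) (e (word w y)) = dist (e x) (e y) / 2 ^ length w"
proof (induction w)
  case (Cons i w)
  have half: "dist (e (F i x)) (e (F i y)) = dist (e x) (e y) / 2" for x y
    by (simp add: e_F dist_norm flip: scaleR_diff_right)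
  show ?case by (simp add: half Cons mult.commute)
qed simp

lemma finite_words: "finite {w :: 3 list. length w = m}"
  using finite_lists_length_eq[of "UNIV :: 3 set" m] by simp

section \<open>Gluing continuous functions along cells\<close>

lemma continuous_e: "continuous_on S e"
  using homeo continuous_on_subset unfolding homeomorphism_def by blast

lemma compact_space: "compact (UNIV :: 'a set)"
proof -
  have "compact (inv e ` SG)"
    using homeo compact_SG unfolding homeomorphism_def by (intro compact_continuous_image) auto
  then show ?thesis using homeo unfolding homeomorphism_def by simp
qed

lemma continuous_word: "continuous_on UNIV (word w)"
proof (induction w)
  case Nil
  then show ?case by (simp add: continuous_on_id word_map_def id_def)
next
  case (Cons i w)
  have "continuous_on SG (inv e)" using homeo unfolding homeomorphism_def by blast
  moreover have "continuous_on UNIV (\<lambda>x. e (F i x))" unfolding e_F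
    by (intro continuous_intros continuous_e)
  ultimately have "continuous_on UNIV (\<lambda>x. inv e (e (F i x)))"
    by (rule continuous_on_compose2) (use e_in_SG in auto)
  moreover have "inv e (e x) = x" for x using homeo unfolding homeomorphism_def by blast
  ultimately have "continuous_on UNIV (F i)" by simp
  then have "continuous_on UNIV (\<lambda>x. F i (word w x))"
    using continuous_on_compose2[OF _ Cons] by auto
  then show ?case by simp
qed

lemma closed_word_image:
  assumes "closed C"
  shows "closed (word w ` C)"
proof -
  have "compact C" using compact_Int_closed[OF compact_space assms] by simp
  then have "compact (e ` word w ` C)"
    using continuous_word continuous_e
    by (intro compact_continuous_image) (auto intro: continuous_on_subset)
  then have "closed (e -` e ` word w ` C)"
    using closed_vimage[OF compact_imp_closed continuous_e] by blast
  moreover have "e -` e ` word w ` C = word w ` C" using e_inject by auto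
  ultimately show ?thesis by simp
qed

lemma bcontfunI: "continuous_on UNIV f \<Longrightarrow> f \<in> bcontfun" for f :: "'a \<Rightarrow> real"
  unfolding bcontfun_def
  using compact_imp_bounded[OF compact_continuous_image[OF _ compact_space]] by blast

text \<open>
  Preimages of closed sets are finite unions of images of closed sets under the maps \<open>word w\<close>, and
  these maps are closed because the gasket is compact.
\<close>

lemma glue:
  fixes h :: "3 list \<Rightarrow> 'a \<Rightarrow>\<^sub>C real"
  assumes agree: "\<And>w w' x y. length w = N \<Longrightarrow> length w' = N \<Longrightarrow> word w x = word w' y \<Longrightarrow> h w x = h w' y"
  obtains H :: "'a \<Rightarrow>\<^sub>C real" where "\<And>w x. length w = N \<Longrightarrow> H (word w x) = h w x"
proof -
  have "\<exists>y. \<forall>w x. length w = N \<longrightarrow> t = word w x \<longrightarrow> h w x = y" for t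
  proof -
    obtain w' x' where "length w' = N" "t = word w' x'" using word_cover by metis
    then show ?thesis using agree by metis
  qed
  then obtain g where g: "\<And>t w x. length w = N \<Longrightarrow> t = word w x \<Longrightarrow> h w x = g t" by metis
  have "continuous_on UNIV g" unfolding continuous_on_closed_vimage[OF closed_UNIV]
  proof (intro allI impI)
    fix C :: "real set" assume "closed C"
    have "g -` C \<inter> UNIV = (\<Union>w\<in>{w. length w = N}. word w ` (apply_bcontfun (h w) -` C))"
      (is "?L = ?R")
    proof (intro equalityI subsetI)
      fix t assume t: "t \<in> ?L"
      obtain w x where "length w = N" "t = word w x" using word_cover by metis
      then show "t \<in> ?R" using t g by auto
    qed (use g in auto)
    also have "closed \<dots>"
      by (intro closed_UN finite_words ballI closed_word_image closed_vimage \<open>closed C\<close>) auto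
    finally show "closed (g -` C \<inter> UNIV)" .
  qed
  then obtain H :: "'a \<Rightarrow>\<^sub>C real" where "g = apply_bcontfun H" using bcontfunE[OF bcontfunI] by metis
  then show ?thesis using that g by metis
qed

end

section \<open>The fractal operator\<close>

locale fractal_gasket = gasket p SG e
  for p :: "3 \<Rightarrow> real^2" and SG and e :: "'a::topological_space \<Rightarrow> real^2" +
  fixes N :: nat and \<alpha> :: "3 list \<Rightarrow> 'a \<Rightarrow>\<^sub>C real" and L :: "('a \<Rightarrow>\<^sub>C real) \<Rightarrow> ('a \<Rightarrow>\<^sub>C real)"
  assumes \<alpha>_less_1: "length \<omega> = N \<Longrightarrow> norm (\<alpha> \<omega>) < 1"
    and linear_L: "linear L"
    and L_boundary: "t \<in> boundary_vertices p e \<Longrightarrow> L f t = f t"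
begin

definition fractal_eq :: "('a \<Rightarrow>\<^sub>C real) \<Rightarrow> ('a \<Rightarrow>\<^sub>C real) \<Rightarrow> bool" where
  "fractal_eq f g \<longleftrightarrow> (\<forall>\<omega> t. length \<omega> = N \<longrightarrow>
     g (word \<omega> t) = f (word \<omega> t) + \<alpha> \<omega> t * (g t - L f t))"

lemma fractal_eqD:
  "fractal_eq f g \<Longrightarrow> length \<omega> = N \<Longrightarrow> g (word \<omega> t) = f (word \<omega> t) + \<alpha> \<omega> t * (g t - L f t)"
  unfolding fractal_eq_def by blast

text \<open>
  There are finitely many words of length $N$, so the maximum of the norms $\|\alpha_\omega\|_\infty$ is a
  common factor below $1$; it bounds the whole sup norm because the cells cover the gasket.
\<close>

lemma fractal_step_contraction:
  obtains c where "0 \<le> c" "c < 1"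
    "\<And>g g' h h'. (\<And>\<omega> t. length \<omega> = N \<Longrightarrow>
      apply_bcontfun h (word \<omega> t) - apply_bcontfun h' (word \<omega> t)
        = \<alpha> \<omega> t * (apply_bcontfun g t - apply_bcontfun g' t)) \<Longrightarrow> dist h h' \<le> c * dist g g'"
proof -
  let ?A = "(\<lambda>\<omega>. norm (\<alpha> \<omega>)) ` {\<omega>. length \<omega> = N}"
  define c where "c = Max ?A"
  have fin: "finite ?A" using finite_words by blast
  have ne: "?A \<noteq> {}" by (metis (mono_tags) empty_iff image_is_empty length_replicate mem_Collect_eq)
  have \<alpha>_le: "\<bar>\<alpha> \<omega> t\<bar> \<le> c" if "length \<omega> = N" for \<omega> t
    using Max_ge[OF fin, of "norm (\<alpha> \<omega>)"] that norm_bounded[of "\<alpha> \<omega>" t] unfolding c_def by force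
  have c1: "c < 1" using Max_in[OF fin ne] \<alpha>_less_1 unfolding c_def by auto
  have c0: "0 \<le> c" using Max_in[OF fin ne] unfolding c_def by auto
  have "dist h h' \<le> c * dist g g'"
    if diff: "\<And>\<omega> t. length \<omega> = N \<Longrightarrow> h (word \<omega> t) - h' (word \<omega> t) = \<alpha> \<omega> t * (g t - g' t)"
    for g g' h h' :: "'a \<Rightarrow>\<^sub>C real"
  proof (rule dist_bound)
    fix s
    obtain \<omega> t where w: "length \<omega> = N" "s = word \<omega> t" using word_cover by metis
    show "dist (h s) (h' s) \<le> c * dist g g'"
      using diff[OF w(1), of t] \<alpha>_le[OF w(1), of t] dist_bounded[of g t g'] c0
      unfolding w(2) by (simp add: abs_mult dist_real_def mult_mono)
  qed
  then show ?thesis by (rule that[OF c0 c1])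
qed

lemma fractal_eq_unique:
  assumes "fractal_eq f g" "fractal_eq f g'"
  shows "g = g'"
proof (rule fractal_step_contraction)
  fix c :: real
  assume c: "0 \<le> c" "c < 1" "\<And>g g' h h'. (\<And>\<omega> t. length \<omega> = N \<Longrightarrow>
      apply_bcontfun h (word \<omega> t) - apply_bcontfun h' (word \<omega> t)
        = \<alpha> \<omega> t * (apply_bcontfun g t - apply_bcontfun g' t)) \<Longrightarrow> dist h h' \<le> c * dist g g'"
  have "dist g g' \<le> c * dist g g'"
    by (rule c(3)) (simp add: fractal_eqD[OF assms(1)] fractal_eqD[OF assms(2)] right_diff_distrib)
  then have "(1 - c) * dist g g' \<le> 0" by (simp add: algebra_simps)
  then have "dist g g' \<le> 0" using c(2) by (simp add: mult_le_0_iff)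
  then show ?thesis by simp
qed

text \<open>
  Banach's fixed-point theorem on the closed set $X$ of continuous functions that agree with $f$ on
  $V_0$. For $g \in X$ the correction $g - Lf$ vanishes on $V_0$, so the prescriptions on neighbouring
  cells agree at their common points and can be glued.
\<close>

lemma fractal_eq_exists: "\<exists>g. fractal_eq f g"
proof (rule fractal_step_contraction)
  fix c :: real
  assume c: "0 \<le> c" "c < 1" "\<And>g g' h h'. (\<And>\<omega> t. length \<omega> = N \<Longrightarrow>
      apply_bcontfun h (word \<omega> t) - apply_bcontfun h' (word \<omega> t)
        = \<alpha> \<omega> t * (apply_bcontfun g t - apply_bcontfun g' t)) \<Longrightarrow> dist h h' \<le> c * dist g g'"
  define X where "X = {g :: 'a \<Rightarrow>\<^sub>C real. \<forall>i. g (v i) = f (v i)}"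
  define step where "step g H \<longleftrightarrow> (\<forall>\<omega> t. length \<omega> = N \<longrightarrow>
     H (word \<omega> t) = f (word \<omega> t) + \<alpha> \<omega> t * (g t - L f t))" for g H :: "'a \<Rightarrow>\<^sub>C real"
  have step_ex: "\<exists>H. step g H" if "g \<in> X" for g
  proof -
    have vanish: "g t - L f t = 0" if "t \<in> range v" for t
      using \<open>g \<in> X\<close> that L_boundary[of t f] boundary_vertices unfolding X_def by auto
    have cont: "continuous_on UNIV (\<lambda>t. f (word \<omega> t) + \<alpha> \<omega> t * (g t - L f t))" for \<omega>
      by (intro continuous_intros continuous_on_compose2[OF _ continuous_word, of UNIV]) auto
    define h where "h \<omega> = Bcontfun (\<lambda>t. f (word \<omega> t) + \<alpha> \<omega> t * (g t - L f t))" for \<omega>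
    have h: "h \<omega> t = f (word \<omega> t) + \<alpha> \<omega> t * (g t - L f t)" for \<omega> t
      unfolding h_def Bcontfun_inverse[OF bcontfunI[OF cont]] ..
    have "h w x = h w' y" if "length w = N" "length w' = N" "word w x = word w' y" for w w' x y
    proof (cases "w = w'")
      case True
      then show ?thesis using that word_inject by simp
    next
      case False
      then have "x \<in> range v" "y \<in> range v"
        using word_meet[of w w' x y] word_meet[of w' w y x] that by auto
      then show ?thesis using h vanish that(3) by simp
    qed
    then obtain H :: "'a \<Rightarrow>\<^sub>C real" where "\<And>w x. length w = N \<Longrightarrow> H (word w x) = h w x"
      using glue by blast
    then show ?thesis unfolding step_def using h by metis
  qed
  \<comment> \<open>off $X$ a glued function need not exist, so the map is chosen there arbitrarily\<close>
  define T where "T g = (SOME H. step g H)" for g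
  have T: "step g (T g)" if "g \<in> X" for g
    unfolding T_def using step_ex[OF that] by (rule someI_ex)
  have "closed X"
  proof -
    have "X = (\<Inter>i. {g. apply_bcontfun g (v i) = f (v i)})" unfolding X_def by auto
    moreover have "continuous_on UNIV (\<lambda>g :: 'a \<Rightarrow>\<^sub>C real. g t)" for t
      by (intro linear_continuous_on bounded_linear_eval)
    ultimately show ?thesis by (auto intro!: closed_INT closed_Collect_eq continuous_intros)
  qed
  then have "uniform_space_class.complete X" using complete_closed_subset[OF _ subset_UNIV complete_bcontfun] by blast
  moreover have "X \<noteq> {}" unfolding X_def by blast
  moreover have "T ` X \<subseteq> X"
  proof
    fix H assume "H \<in> T ` X"
    then obtain g where g: "g \<in> X" "H = T g" by blast
    \<comment> \<open>$p_i$ is the fixed point of the map with the constant word $i \cdots i$\<close>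
    have "H (v i) = f (v i)" for i
      using T[OF g(1), unfolded step_def, rule_format, of "replicate N i" "v i"] g
        L_boundary[of "v i" f] boundary_vertices unfolding X_def by (simp add: word_replicate_v)
    then show "H \<in> X" unfolding X_def by blast
  qed
  moreover have "dist (T g) (T g') \<le> c * dist g g'" if "g \<in> X" "g' \<in> X" for g g'
  proof (rule c(3))
    fix \<omega> :: "3 list" and t assume w: "length \<omega> = N"
    show "T g (word \<omega> t) - T g' (word \<omega> t) = \<alpha> \<omega> t * (g t - g' t)"
      using T[OF that(1), unfolded step_def, rule_format, OF w, of t]
        T[OF that(2), unfolded step_def, rule_format, OF w, of t] by (simp add: right_diff_distrib)
  qed
  ultimately obtain g where "g \<in> X" "T g = g" using Banach_fix[of X c T] c by blast
  then have "step g g" using T by metis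
  then show ?thesis unfolding step_def fractal_eq_def by blast
qed

lemma fractal_operator_eqI: "fractal_eq f g \<Longrightarrow> fractal_operator p e N \<alpha> L f = g"
  unfolding fractal_operator_def fractal_eq_def[symmetric] using fractal_eq_unique by blast

lemma fractal_eq_fractal_operator: "fractal_eq f (fractal_operator p e N \<alpha> L f)"
  using fractal_eq_exists fractal_operator_eqI by metis

text \<open>
  The functional equation is linear in the pair $(f, f^\alpha)$, so this follows from uniqueness of its
  solution.
\<close>

lemma linear_fractal_operator: "linear (fractal_operator p e N \<alpha> L)"
proof (rule linearI; rule fractal_operator_eqI)
  fix f g
  show "fractal_eq (f + g) (fractal_operator p e N \<alpha> L f + fractal_operator p e N \<alpha> L g)"
    unfolding fractal_eq_def[of "f + g"] linear_add[OF linear_L]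
    by (simp add: fractal_eqD[OF fractal_eq_fractal_operator] algebra_simps)
next
  fix r f
  show "fractal_eq (r *\<^sub>R f) (r *\<^sub>R fractal_operator p e N \<alpha> L f)"
    unfolding fractal_eq_def[of "r *\<^sub>R f"] linear_scale[OF linear_L]
    by (simp add: fractal_eqD[OF fractal_eq_fractal_operator] algebra_simps)
qed

end

section \<open>Energy\<close>

context gasket
begin

definition cell_energy :: "('a \<Rightarrow> real) \<Rightarrow> ('a \<Rightarrow> real) \<Rightarrow> real" where
  "cell_energy f g = (\<Sum>i\<in>UNIV. \<Sum>j\<in>UNIV. (f (v i) - f (v j)) * (g (v i) - g (v j))) / 2"

text \<open>
  Each edge of the level-$m$ graph comes from exactly one word and one pair of distinct vertices, so the
  sum over ordered neighbours can be reorganised cell by cell. The diagonal terms added to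
  \<open>cell_energy\<close> are zero.
\<close>

lemma level_energy_cells:
  "level_energy p e m f g =
    (5/3) ^ m * (\<Sum>w | length w = m. cell_energy (\<lambda>t. f (word w t)) (\<lambda>t. g (word w t)))"
proof -
  let ?W = "{w :: 3 list. length w = m}" and ?E = "{(i :: 3, j :: 3). i \<noteq> j}"
  let ?\<phi> = "\<lambda>(w, i, j). (word w (v i), word w (v j))"
  let ?G = "\<lambda>(x, y). (f x - f y) * (g x - g y)"
  have inj: "inj_on ?\<phi> (?W \<times> ?E)"
  proof (rule inj_onI)
    fix a b assume a: "a \<in> ?W \<times> ?E" and b: "b \<in> ?W \<times> ?E" and eq: "?\<phi> a = ?\<phi> b"
    obtain w i j where a': "a = (w, i, j)" "length w = m" "i \<noteq> j" using a by auto
    obtain w' i' j' where b': "b = (w', i', j')" "length w' = m" using b by auto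
    have h: "word w (v i) = word w' (v i')" "word w (v j) = word w' (v j')" using eq a' b' by auto
    have "w = w'" using word_meet_unique[OF _ h] a' b' v_inject by metis
    then show "a = b" using h a' b' by (simp add: word_inject v_inject)
  qed
  have img: "?\<phi> ` (?W \<times> ?E) = {(x, y). adjacent p e m x y}"
  proof (intro equalityI subsetI)
    fix z assume "z \<in> ?\<phi> ` (?W \<times> ?E)"
    then obtain w i j where w: "length w = m" "i \<noteq> j" "z = (word w (v i), word w (v j))" by auto
    then show "z \<in> {(x, y). adjacent p e m x y}"
      unfolding adjacent_def vertices_def boundary_vertices by (auto simp: word_inject v_inject)
  next
    fix z assume "z \<in> {(x, y). adjacent p e m x y}"
    then obtain x y w where xy: "z = (x, y)" "x \<noteq> y" "length w = m"
      "x \<in> word w ` range v" "y \<in> word w ` range v"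
      unfolding adjacent_def boundary_vertices by blast
    then obtain i j where ij: "x = word w (v i)" "y = word w (v j)" by blast
    then have "i \<noteq> j" using xy(2) by blast
    then show "z \<in> ?\<phi> ` (?W \<times> ?E)" using xy ij by (auto intro!: image_eqI[of _ _ "(w, i, j)"])
  qed
  have "(\<Sum>z | (case z of (x, y) \<Rightarrow> adjacent p e m x y). ?G z) = (\<Sum>z\<in>?W \<times> ?E. ?G (?\<phi> z))"
    unfolding img[symmetric] by (simp add: sum.reindex[OF inj])
  also have "\<dots> = (\<Sum>w\<in>?W. \<Sum>(i, j)\<in>?E. ?G (word w (v i), word w (v j)))"
    by (simp add: sum.cartesian_product case_prod_unfold)
  also have "\<dots> = (\<Sum>w\<in>?W. 2 * cell_energy (\<lambda>t. f (word w t)) (\<lambda>t. g (word w t)))"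
  proof (rule sum.cong[OF refl])
    fix w :: "3 list"
    have "(\<Sum>(i, j)\<in>?E. ?G (word w (v i), word w (v j))) =
      (\<Sum>(i, j)\<in>UNIV. ?G (word w (v i), word w (v j)))"
      by (rule sum.mono_neutral_left) auto
    then show "(\<Sum>(i, j)\<in>?E. ?G (word w (v i), word w (v j))) =
      2 * cell_energy (\<lambda>t. f (word w t)) (\<lambda>t. g (word w t))"
      unfolding cell_energy_def by (simp add: sum.cartesian_product)
  qed
  finally show ?thesis
    unfolding level_energy_def by (simp add: sum_distrib_left)
qed

lemma cell_energy_nonneg: "0 \<le> cell_energy f f"
  unfolding cell_energy_def by (simp add: sum_nonneg)

lemma cell_energy_add: "cell_energy (\<lambda>t. f t + g t) h = cell_energy f h + cell_energy g h"
  unfolding cell_energy_def by (simp add: algebra_simps add_divide_distrib flip: sum.distrib)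

lemma cell_energy_scale: "cell_energy (\<lambda>t. c * f t) h = c * cell_energy f h"
  unfolding cell_energy_def by (simp add: sum_distrib_left algebra_simps)

lemma cell_energy_commute: "cell_energy f g = cell_energy g f"
  unfolding cell_energy_def by (simp add: mult.commute)

lemma level_energy_add: "level_energy p e m (\<lambda>t. f t + g t) h = level_energy p e m f h + level_energy p e m g h"
  unfolding level_energy_cells cell_energy_add by (simp add: sum.distrib distrib_left)

lemma level_energy_scale: "level_energy p e m (\<lambda>t. c * f t) h = c * level_energy p e m f h"
  unfolding level_energy_cells cell_energy_scale by (simp add: algebra_simps flip: sum_distrib_left)

lemma level_energy_commute: "level_energy p e m f g = level_energy p e m g f"
  unfolding level_energy_cells using cell_energy_commute by metis

lemma level_energy_nonneg: "0 \<le> level_energy p e m f f"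
  unfolding level_energy_cells using cell_energy_nonneg by (simp add: sum_nonneg)

text \<open>
  Given the values $a, b, c$ at the corners, the energy of the next level is minimal when the values at
  the midpoints follow the harmonic extension rule with weights $2/5, 2/5, 1/5$, and the minimum is $3/5$
  of the energy of the cell. $X$, $Y$, $Z$ are the deviations from that rule, in which the excess is a
  sum of squares.
\<close>

lemma cell_energy_subdivide:
  "cell_energy f f \<le> 5/3 * (\<Sum>k\<in>UNIV. cell_energy (\<lambda>t. f (F k t)) (\<lambda>t. f (F k t)))"
proof -
  define a b c where "a = f (v 1)" and "b = f (v 2)" and "c = f (v 3)"
  define x y z where "x = f (F 2 (v 3))" and "y = f (F 3 (v 1))" and "z = f (F 1 (v 2))"
  have sym: "f (F 3 (v 2)) = x" "f (F 1 (v 3)) = y" "f (F 2 (v 1)) = z"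
    unfolding x_def y_def z_def by (simp_all add: F_v)
  define X Y Z where "X = x - (a + 2 * b + 2 * c) / 5" and "Y = y - (2 * a + b + 2 * c) / 5"
    and "Z = z - (2 * a + 2 * b + c) / 5"
  have 1: "cell_energy f f = (a - b)\<^sup>2 + (b - c)\<^sup>2 + (c - a)\<^sup>2"
    unfolding cell_energy_def sum_3 a_def b_def c_def by (simp add: power2_eq_square field_simps)
  have 2: "(\<Sum>k\<in>UNIV. cell_energy (\<lambda>t. f (F k t)) (\<lambda>t. f (F k t))) =
    ((a - z)\<^sup>2 + (a - y)\<^sup>2 + (z - y)\<^sup>2) + ((z - b)\<^sup>2 + (b - x)\<^sup>2 + (x - z)\<^sup>2)
    + ((y - x)\<^sup>2 + (x - c)\<^sup>2 + (c - y)\<^sup>2)"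
    unfolding cell_energy_def sum_3
    by (simp add: F_v_same sym flip: a_def b_def c_def x_def y_def z_def)
      (simp add: power2_eq_square field_simps)
  have "5/3 * (\<Sum>k\<in>UNIV. cell_energy (\<lambda>t. f (F k t)) (\<lambda>t. f (F k t))) - cell_energy f f
    = 5/3 * ((X - Y)\<^sup>2 + (Y - Z)\<^sup>2 + (Z - X)\<^sup>2 + 2 * X\<^sup>2 + 2 * Y\<^sup>2 + 2 * Z\<^sup>2)"
    unfolding 1 2 X_def Y_def Z_def by (simp add: power2_eq_square field_simps)
  moreover have "0 \<le> 5/3 * ((X - Y)\<^sup>2 + (Y - Z)\<^sup>2 + (Z - X)\<^sup>2 + 2 * X\<^sup>2 + 2 * Y\<^sup>2 + 2 * Z\<^sup>2)"
    by simp
  ultimately show ?thesis by linarith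
qed

text \<open>
  Words of length $m+1$ arise from words of length $m$ by appending a letter, which subdivides each
  cell.
\<close>

lemma level_energy_mono_Suc: "level_energy p e m f f \<le> level_energy p e (Suc m) f f"
proof -
  let ?W = "\<lambda>m. {w :: 3 list. length w = m}"
  let ?C = "\<lambda>w. cell_energy (\<lambda>t. f (word w t)) (\<lambda>t. f (word w t))"
  have inj: "inj_on (\<lambda>(w, k). w @ [k]) (?W m \<times> UNIV)" by (auto simp: inj_on_def)
  have img: "?W (Suc m) = (\<lambda>(w, k). w @ [k]) ` (?W m \<times> UNIV)"
  proof (intro equalityI subsetI)
    fix w assume "w \<in> ?W (Suc m)"
    then have "w \<noteq> []" by auto
    then have "w = butlast w @ [last w]" "length (butlast w) = m" using \<open>w \<in> ?W (Suc m)\<close> by auto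
    then show "w \<in> (\<lambda>(w, k). w @ [k]) ` (?W m \<times> UNIV)"
      by (auto intro!: image_eqI[of _ _ "(butlast w, last w)"])
  qed auto
  have "sum ?C (?W (Suc m)) = (\<Sum>(w, k)\<in>?W m \<times> UNIV. ?C (w @ [k]))"
    unfolding img by (subst sum.reindex[OF inj]) (simp add: case_prod_unfold comp_def)
  also have "\<dots> = (\<Sum>w\<in>?W m. \<Sum>k\<in>UNIV. ?C (w @ [k]))" by (simp add: sum.cartesian_product)
  finally have eq: "sum ?C (?W (Suc m)) = (\<Sum>w\<in>?W m. \<Sum>k\<in>UNIV. ?C (w @ [k]))" .
  have "sum ?C (?W m) \<le> (\<Sum>w\<in>?W m. 5/3 * (\<Sum>k\<in>UNIV. ?C (w @ [k])))"
  proof (rule sum_mono)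
    fix w :: "3 list"
    show "?C w \<le> 5/3 * (\<Sum>k\<in>UNIV. ?C (w @ [k]))"
      using cell_energy_subdivide[of "\<lambda>t. f (word w t)"] by (simp add: word_append)
  qed
  also have "\<dots> = 5/3 * sum ?C (?W (Suc m))" unfolding eq by (rule sum_distrib_left[symmetric])
  finally have "(5/3) ^ m * sum ?C (?W m) \<le> (5/3) ^ m * (5/3 * sum ?C (?W (Suc m)))"
    by (rule mult_left_mono) simp
  then show ?thesis unfolding level_energy_cells by (simp add: mult.assoc mult.left_commute)
qed

lemma level_energy_mono: "m \<le> k \<Longrightarrow> level_energy p e m f f \<le> level_energy p e k f f"
  by (rule lift_Suc_mono_le[of "\<lambda>m. level_energy p e m f f"]) (rule level_energy_mono_Suc)

text \<open>
  By monotonicity the limit in the definition of the energy is the supremum.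
\<close>

lemma dom_energy_iff: "f \<in> dom_energy p e \<longleftrightarrow> (\<exists>C. \<forall>m. level_energy p e m f f \<le> C)"
proof -
  let ?E = "\<lambda>m. ereal (level_energy p e m f f)"
  have inc: "incseq ?E" unfolding incseq_def using level_energy_mono by simp
  have lim: "energy p e f = (SUP m. ?E m)"
    unfolding energy_def by (rule limI[OF LIMSEQ_SUP[OF inc]])
  show ?thesis
  proof
    assume "f \<in> dom_energy p e"
    then have "(SUP m. ?E m) < \<infinity>" using lim unfolding dom_energy_def by simp
    moreover have "?E 0 \<le> (SUP m. ?E m)" by (rule SUP_upper) simp
    ultimately obtain C where C: "(SUP m. ?E m) = ereal C"
      by (cases "SUP m. ?E m") auto
    have "?E m \<le> ereal C" for m unfolding C[symmetric] by (rule SUP_upper) simp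
    then show "\<exists>C. \<forall>m. level_energy p e m f f \<le> C" by auto
  next
    assume "\<exists>C. \<forall>m. level_energy p e m f f \<le> C"
    then obtain C where "\<And>m. level_energy p e m f f \<le> C" by blast
    then have "(SUP m. ?E m) \<le> ereal C" by (intro SUP_least) simp
    then show "f \<in> dom_energy p e" using lim unfolding dom_energy_def by auto
  qed
qed

lemma dom_energy_add:
  assumes "f \<in> dom_energy p e" "g \<in> dom_energy p e"
  shows "f + g \<in> dom_energy p e"
proof -
  obtain C D where CD: "\<And>m. level_energy p e m f f \<le> C" "\<And>m. level_energy p e m g g \<le> D"
    using assms unfolding dom_energy_iff by blast
  have "level_energy p e m (f + g) (f + g) \<le> 2 * C + 2 * D" for m
  proof -
    have "0 \<le> level_energy p e m (\<lambda>t. f t + (-1) * g t) (\<lambda>t. f t + (-1) * g t)"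
      by (rule level_energy_nonneg)
    also have "\<dots> = level_energy p e m f f - 2 * level_energy p e m f g + level_energy p e m g g"
      unfolding level_energy_add level_energy_scale
        level_energy_commute[of m f "\<lambda>t. f t + (-1) * g t"] level_energy_commute[of m g "\<lambda>t. f t + (-1) * g t"]
      by (simp add: level_energy_commute[of m g f])
    finally have "2 * level_energy p e m f g \<le> level_energy p e m f f + level_energy p e m g g" by simp
    moreover have "level_energy p e m (f + g) (f + g) =
      level_energy p e m f f + 2 * level_energy p e m f g + level_energy p e m g g"
      unfolding plus_bcontfun.rep_eq level_energy_add
        level_energy_commute[of m f "\<lambda>t. f t + g t"] level_energy_commute[of m g "\<lambda>t. f t + g t"]
      by (simp add: level_energy_commute[of m g f])
    ultimately show ?thesis using CD(1)[of m] CD(2)[of m] by linarith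
  qed
  then show ?thesis unfolding dom_energy_iff by blast
qed

lemma dom_energy_scale:
  assumes "f \<in> dom_energy p e"
  shows "c *\<^sub>R f \<in> dom_energy p e"
proof -
  obtain C where C: "\<And>m. level_energy p e m f f \<le> C" using assms unfolding dom_energy_iff by blast
  have "level_energy p e m (c *\<^sub>R f) (c *\<^sub>R f) = c * (c * level_energy p e m f f)" for m
    unfolding scaleR_bcontfun.rep_eq real_scaleR_def level_energy_scale
      level_energy_commute[of m f "\<lambda>t. c * f t"] ..
  also have "c * (c * level_energy p e m f f) \<le> (c * c) * C" for m
    using mult_left_mono[OF C, of "c * c" m] by (simp add: mult.assoc)
  finally show ?thesis unfolding dom_energy_iff by blast
qed

text \<open>
  By polarisation, from the convergence of the bounded increasing sequences of level energies.
\<close>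

lemma energy_form_tendsto:
  assumes "f \<in> dom_energy p e" "g \<in> dom_energy p e"
  shows "(\<lambda>m. level_energy p e m f g) \<longlonglongrightarrow> energy_form p e f g"
proof -
  have conv: "convergent (\<lambda>m. level_energy p e m h h)" if h: "h \<in> dom_energy p e" for h :: "'a \<Rightarrow>\<^sub>C real"
  proof -
    obtain C where C: "\<forall>m. level_energy p e m h h \<le> C" using h unfolding dom_energy_iff by blast
    have "incseq (\<lambda>m. level_energy p e m h h)" unfolding incseq_def using level_energy_mono by simp
    from incseq_convergent[OF this C] obtain l where "(\<lambda>m. level_energy p e m h h) \<longlonglongrightarrow> l" .
    then show ?thesis by (rule convergentI)
  qed
  have eq: "level_energy p e m f g = (level_energy p e m (f + g) (f + g)
      - level_energy p e m f f - level_energy p e m g g) / 2" for m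
    unfolding plus_bcontfun.rep_eq level_energy_add
      level_energy_commute[of m f "\<lambda>t. f t + g t"] level_energy_commute[of m g "\<lambda>t. f t + g t"]
    by (simp add: level_energy_commute[of m g f])
  have "convergent (\<lambda>m. (level_energy p e m (f + g) (f + g)
      - level_energy p e m f f - level_energy p e m g g) / 2)"
    unfolding divide_inverse
    by (intro convergent_mult convergent_diff conv dom_energy_add assms convergent_const)
  then have "convergent (\<lambda>m. level_energy p e m f g)" by (simp only: eq)
  then show ?thesis unfolding energy_form_def by (simp add: convergent_LIMSEQ_iff)
qed

lemma energy_form_add:
  assumes "f \<in> dom_energy p e" "g \<in> dom_energy p e" "h \<in> dom_energy p e"
  shows "energy_form p e (f + g) h = energy_form p e f h + energy_form p e g h"
proof (rule LIMSEQ_unique)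
  show "(\<lambda>m. level_energy p e m (f + g) h) \<longlonglongrightarrow> energy_form p e (f + g) h"
    by (intro energy_form_tendsto dom_energy_add assms)
  show "(\<lambda>m. level_energy p e m (f + g) h) \<longlonglongrightarrow> energy_form p e f h + energy_form p e g h"
    unfolding plus_bcontfun.rep_eq level_energy_add
    by (intro tendsto_add energy_form_tendsto assms)
qed

lemma energy_form_scale:
  assumes "f \<in> dom_energy p e" "h \<in> dom_energy p e"
  shows "energy_form p e (c *\<^sub>R f) h = c * energy_form p e f h"
proof (rule LIMSEQ_unique)
  show "(\<lambda>m. level_energy p e m (c *\<^sub>R f) h) \<longlonglongrightarrow> energy_form p e (c *\<^sub>R f) h"
    by (intro energy_form_tendsto dom_energy_scale assms)
  show "(\<lambda>m. level_energy p e m (c *\<^sub>R f) h) \<longlonglongrightarrow> c * energy_form p e f h"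
    unfolding scaleR_bcontfun.rep_eq real_scaleR_def level_energy_scale
    by (intro tendsto_mult tendsto_const energy_form_tendsto assms)
qed

text \<open>
  Already the images of a single vertex are dense: each point lies in a cell of every level $m$, and the
  diameters of these cells are of order $2^{-m}$.
\<close>

lemma vertices_dense:
  fixes f :: "'a \<Rightarrow>\<^sub>C real"
  assumes zero: "\<And>w. f (word w (v 1)) = 0"
  shows "f = 0"
proof (rule bcontfun_eqI)
  fix t
  have "\<exists>w x. length w = m \<and> t = word w x" for m by (rule word_cover)
  then obtain w x where w: "\<And>m. length (w m) = m" "\<And>m. t = word (w m) (x m)" by metis
  define y where "y m = word (w m) (v 1)" for m
  obtain K where K: "\<And>a b. dist (e a) (e b) \<le> K"
    using compact_imp_bounded[OF compact_SG] e_in_SG unfolding bounded_two_points by blast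
  have "norm (dist (e (y m)) (e t)) \<le> K * (1/2) ^ m" for m
    using divide_right_mono[OF K[of "v 1" "x m"], of "2 ^ m"] dist_word[of "w m" "v 1" "x m"] w[of m]
    unfolding y_def by (simp add: power_one_over)
  moreover have "(\<lambda>m. K * (1/2) ^ m) \<longlonglongrightarrow> 0"
    by (intro tendsto_mult_right_zero LIMSEQ_power_zero) simp
  ultimately have "(\<lambda>m. dist (e (y m)) (e t)) \<longlonglongrightarrow> 0"
    by (rule Lim_null_comparison[OF eventuallyI])
  then have "(\<lambda>m. e (y m)) \<longlonglongrightarrow> e t" by (rule tendsto_dist_iff[THEN iffD2])
  moreover have "continuous_on SG (\<lambda>z. f (inv e z))"
    using homeo by (intro continuous_on_compose2[OF continuous_on_apply_bcontfun[of UNIV f]])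
      (auto simp: homeomorphism_def)
  ultimately have "(\<lambda>m. f (inv e (e (y m)))) \<longlonglongrightarrow> f (inv e (e t))"
    using e_in_SG by (intro continuous_on_tendsto_compose[of SG "\<lambda>z. f (inv e z)"]) auto
  moreover have "inv e (e z) = z" for z using homeo unfolding homeomorphism_def by blast
  ultimately have "(\<lambda>m. f (y m)) \<longlonglongrightarrow> f t" by simp
  then show "f t = apply_bcontfun 0 t" using zero unfolding y_def by (simp add: LIMSEQ_const_iff)
qed

text \<open>
  All level energies are at most the energy, so they vanish and $f$ is constant on the vertices of each
  cell. A cell and its subcell share a vertex, which carries the boundary value $0$ down to all levels.
\<close>

lemma energy_zero:
  assumes f: "f \<in> dom0_energy p e" and E: "energy_form p e f f = 0"
  shows "f = 0"
proof (rule vertices_dense)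
  have dom: "f \<in> dom_energy p e" and bd: "\<And>i. f (v i) = 0"
    using f boundary_vertices unfolding dom0_energy_def by auto
  have "level_energy p e m f f = 0" for m
  proof (rule antisym[OF _ level_energy_nonneg])
    have "level_energy p e m f f \<le> energy_form p e f f"
      by (rule incseq_le[OF _ energy_form_tendsto[OF dom dom]]) (simp add: incseq_def level_energy_mono)
    then show "level_energy p e m f f \<le> 0" using E by simp
  qed
  then have cell: "cell_energy (\<lambda>t. f (word w t)) (\<lambda>t. f (word w t)) = 0" for w
    using sum_nonneg_eq_0_iff[OF finite_words[of "length w"], of "\<lambda>w. cell_energy (\<lambda>t. f (word w t)) (\<lambda>t. f (word w t))"]
      cell_energy_nonneg unfolding level_energy_cells by auto
  have const: "f (word w (v i)) = f (word w (v j))" for w i j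
    using cell[of w] unfolding cell_energy_def
    by (simp add: sum_nonneg_eq_0_iff sum_nonneg)
  have "f (word w (v i)) = 0" for w i
  proof (induction w arbitrary: i rule: rev_induct)
    case Nil
    then show ?case using bd by simp
  next
    case (snoc k w)
    have "f (word (w @ [k]) (v i)) = f (word (w @ [k]) (v k))" by (rule const)
    also have "\<dots> = f (word w (v k))" by (simp add: word_append F_v_same)
    finally show ?case using snoc by simp
  qed
  then show "f (word w (v 1)) = 0" for w by blast
qed

end

section \<open>Polynomials\<close>

locale gasket_measure = gasket p SG e
  for p :: "3 \<Rightarrow> real^2" and SG and e :: "'a::topological_space \<Rightarrow> real^2" +
  fixes \<mu> :: "'a measure"
  assumes prob: "prob_space \<mu>" and sets_borel: "sets \<mu> = sets borel"
begin

lemma integrable_product: "integrable \<mu> (\<lambda>t. f t * g t)" for f g :: "'a \<Rightarrow>\<^sub>C real"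
proof -
  interpret prob_space \<mu> by (rule prob)
  have "continuous_on UNIV (\<lambda>t. f t * g t)" by (intro continuous_intros) auto
  then have "(\<lambda>t. f t * g t) \<in> borel_measurable \<mu>"
    using borel_measurable_continuous_onI measurable_cong_sets[OF sets_borel refl] by blast
  moreover have "norm (f t * g t) \<le> norm f * norm g" for t
    using norm_bounded[of f t] norm_bounded[of g t] by (simp add: abs_mult mult_mono)
  ultimately show ?thesis using integrable_const_bound[of "\<lambda>t. f t * g t" "norm f * norm g"] by simp
qed

lemma is_laplacian_add:
  assumes "is_laplacian p e \<mu> f f'" "is_laplacian p e \<mu> g g'"
  shows "is_laplacian p e \<mu> (f + g) (f' + g')"
  unfolding is_laplacian_def
proof (intro conjI ballI)
  have dom: "f \<in> dom_energy p e" "g \<in> dom_energy p e" using assms unfolding is_laplacian_def by auto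
  then show "f + g \<in> dom_energy p e" by (rule dom_energy_add)
  fix h assume h: "h \<in> dom0_energy p e"
  then have "h \<in> dom_energy p e" unfolding dom0_energy_def by blast
  then have "energy_form p e (f + g) h = energy_form p e f h + energy_form p e g h"
    using energy_form_add dom by blast
  also have "\<dots> = - (\<integral>t. f' t * h t + g' t * h t \<partial>\<mu>)"
    using assms h integrable_product unfolding is_laplacian_def by simp
  finally show "energy_form p e (f + g) h = - (\<integral>t. (f' + g') t * h t \<partial>\<mu>)"
    by (simp add: distrib_right)
qed

lemma is_laplacian_scale:
  assumes "is_laplacian p e \<mu> f f'"
  shows "is_laplacian p e \<mu> (c *\<^sub>R f) (c *\<^sub>R f')"
  unfolding is_laplacian_def
proof (intro conjI ballI)
  have dom: "f \<in> dom_energy p e" using assms unfolding is_laplacian_def by auto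
  then show "c *\<^sub>R f \<in> dom_energy p e" by (rule dom_energy_scale)
  fix h assume h: "h \<in> dom0_energy p e"
  then have "h \<in> dom_energy p e" unfolding dom0_energy_def by blast
  then have "energy_form p e (c *\<^sub>R f) h = c * energy_form p e f h"
    using energy_form_scale dom by blast
  then show "energy_form p e (c *\<^sub>R f) h = - (\<integral>t. (c *\<^sub>R f') t * h t \<partial>\<mu>)"
    using assms h unfolding is_laplacian_def by (simp add: mult.assoc)
qed

lemma is_laplacian_zero: "is_laplacian p e \<mu> 0 0"
proof -
  have "(0 :: 'a \<Rightarrow>\<^sub>C real) \<in> dom_energy p e"
    unfolding dom_energy_iff level_energy_cells cell_energy_def by auto
  moreover have "energy_form p e (0 :: 'a \<Rightarrow>\<^sub>C real) h = 0" for h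
    unfolding energy_form_def level_energy_cells cell_energy_def by simp
  ultimately show ?thesis unfolding is_laplacian_def by simp
qed

definition laplacian_graph :: "(('a \<Rightarrow>\<^sub>C real) \<times> ('a \<Rightarrow>\<^sub>C real)) set" where
  "laplacian_graph = {(f, g). is_laplacian p e \<mu> f g}"

lemma subspace_laplacian_graph: "subspace laplacian_graph"
  unfolding subspace_def laplacian_graph_def
  using is_laplacian_zero is_laplacian_add is_laplacian_scale
  by (auto simp: zero_prod_def)

end

text \<open>
  Rank-nullity for a linear relation: preimages of a basis of the second projection, together with
  generators of the kernel, generate the first projection. It is applied to the graph
  of $\Delta$ and to the map that restricts a harmonic function to $V_0$.
\<close>

lemma finite_span_of_linear_relation:
  fixes S :: "('x::real_vector \<times> 'y::real_vector) set"
  assumes S: "subspace S" and img: "finite A" "snd ` S \<subseteq> span A"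
    and ker: "finite B" "\<And>x. (x, 0) \<in> S \<Longrightarrow> x \<in> span B"
  shows "\<exists>C. finite C \<and> fst ` S \<subseteq> span C"
proof -
  have "subspace (snd ` S)" by (rule linear_subspace_image[OF linear_snd S])
  then obtain D where D: "finite D" "span D = snd ` S" using subspace_of_finite_span img by metis
  have "\<forall>d\<in>D. \<exists>x. (x, d) \<in> S" using D(2) span_superset[of D] by force
  then obtain \<psi> where \<psi>: "\<And>d. d \<in> D \<Longrightarrow> (\<psi> d, d) \<in> S" by metis
  have "x \<in> span (B \<union> \<psi> ` D)" if "(x, y) \<in> S" for x y
  proof -
    have "y \<in> span D" using that D(2) by force
    then obtain u where y: "y = (\<Sum>d\<in>D. u d *\<^sub>R d)" using span_finite[OF D(1)] by auto
    have "(\<Sum>d\<in>D. u d *\<^sub>R (\<psi> d, d)) \<in> S"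
      by (intro subspace_sum[OF S] subspace_scale[OF S] \<psi>)
    moreover have "(\<Sum>d\<in>D. u d *\<^sub>R (\<psi> d, d)) = ((\<Sum>d\<in>D. u d *\<^sub>R \<psi> d), y)"
      unfolding y by (simp add: prod_eq_iff fst_sum snd_sum)
    ultimately have "(x, y) - ((\<Sum>d\<in>D. u d *\<^sub>R \<psi> d), y) \<in> S" using subspace_diff[OF S that] by metis
    then have "x - (\<Sum>d\<in>D. u d *\<^sub>R \<psi> d) \<in> span B" using ker(2) by simp
    then have "x - (\<Sum>d\<in>D. u d *\<^sub>R \<psi> d) \<in> span (B \<union> \<psi> ` D)" using span_mono by blast
    moreover have "(\<Sum>d\<in>D. u d *\<^sub>R \<psi> d) \<in> span (B \<union> \<psi> ` D)"
      by (intro span_sum span_scale span_base) auto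
    ultimately show ?thesis using span_add by fastforce
  qed
  then show ?thesis using img ker D(1) by (intro exI[of _ "B \<union> \<psi> ` D"]) auto
qed

context gasket_measure
begin

lemma subspace_harmonic: "subspace {f. is_laplacian p e \<mu> f 0}"
  unfolding subspace_def
  using is_laplacian_zero is_laplacian_add[of _ 0 _ 0] is_laplacian_scale[of _ 0] by simp

text \<open>
  A harmonic function with zero boundary values is an admissible test function for itself, so its energy
  is zero. Hence harmonic functions are determined by their three boundary values.
\<close>

lemma harmonic_finite_span: "\<exists>B. finite B \<and> {f. is_laplacian p e \<mu> f 0} \<subseteq> span B"
proof -
  define bd :: "('a \<Rightarrow>\<^sub>C real) \<Rightarrow> real^3" where "bd f = (\<chi> i. f (v i))" for f
  have lin: "linear bd" by (rule linearI) (simp_all add: bd_def vec_eq_iff)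
  define S where "S = (\<lambda>f. (f, bd f)) ` {f. is_laplacian p e \<mu> f 0}"
  note subspace_harmonic
  moreover have "linear (\<lambda>f. (f, bd f))"
    by (rule linearI) (simp_all add: linear_add[OF lin] linear_scale[OF lin])
  ultimately have S: "subspace S" unfolding S_def by (intro linear_subspace_image)
  have inj: "f = 0" if "(f, 0) \<in> S" for f
  proof -
    have f: "is_laplacian p e \<mu> f 0" "bd f = 0" using that unfolding S_def by auto
    then have "f \<in> dom0_energy p e"
      unfolding dom0_energy_def is_laplacian_def boundary_vertices bd_def by (auto simp: vec_eq_iff)
    moreover from this have "energy_form p e f f = 0" using f(1) unfolding is_laplacian_def by simp
    ultimately show ?thesis by (rule energy_zero)
  qed
  have "\<exists>C. finite C \<and> fst ` S \<subseteq> span C"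
    by (rule finite_span_of_linear_relation[OF S finite_Basis _ finite.emptyI])
      (use inj in auto)
  moreover have "fst ` S = {f. is_laplacian p e \<mu> f 0}" unfolding S_def by force
  ultimately show ?thesis by simp
qed

lemma polynomials_0: "polynomials p e \<mu> 0 = {f. is_laplacian p e \<mu> f 0}"
  unfolding polynomials_def by (simp add: eq_OO)

lemma polynomials_Suc: "polynomials p e \<mu> (Suc n) = {f. \<exists>g\<in>polynomials p e \<mu> n. is_laplacian p e \<mu> f g}"
proof -
  have "(is_laplacian p e \<mu> ^^ Suc (Suc n)) f 0 \<longleftrightarrow>
    (\<exists>g. is_laplacian p e \<mu> f g \<and> (is_laplacian p e \<mu> ^^ Suc n) g 0)" for f
    using relpowp_Suc_D2[of "Suc n" "is_laplacian p e \<mu>"] relpowp_Suc_I2[of "is_laplacian p e \<mu>"] by metis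
  then show ?thesis unfolding polynomials_def by auto
qed

text \<open>
  The polynomials of order $n+1$ are the first projection of the part of the graph of $\Delta$ that lies
  over the polynomials of order $n$; the kernel consists of the harmonic functions.
\<close>

lemma polynomials_finite_dim:
  "subspace (polynomials p e \<mu> n) \<and> (\<exists>B. finite B \<and> polynomials p e \<mu> n \<subseteq> span B)"
proof (induction n)
  case 0
  show ?case using subspace_harmonic harmonic_finite_span polynomials_0 by simp
next
  case (Suc n)
  let ?P = "polynomials p e \<mu> n"
  define S where "S = laplacian_graph \<inter> (UNIV \<times> ?P)"
  have "subspace (UNIV \<times> ?P :: (('a \<Rightarrow>\<^sub>C real) \<times> ('a \<Rightarrow>\<^sub>C real)) set)"
    using Suc by (intro subspace_Times) auto
  then have S: "subspace S" unfolding S_def by (intro subspace_inter subspace_laplacian_graph)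
  have fst: "fst ` S = polynomials p e \<mu> (Suc n)"
    unfolding polynomials_Suc S_def laplacian_graph_def by force
  obtain A where A: "finite A" "?P \<subseteq> span A" using Suc by blast
  obtain B where B: "finite B" "{f. is_laplacian p e \<mu> f 0} \<subseteq> span B"
    using harmonic_finite_span by blast
  have "\<exists>C. finite C \<and> fst ` S \<subseteq> span C"
    by (rule finite_span_of_linear_relation[OF S A(1) _ B(1)])
      (use A B in \<open>auto simp: S_def laplacian_graph_def\<close>)
  moreover have "subspace (fst ` S)" by (rule linear_subspace_image[OF linear_fst S])
  ultimately show ?case using fst by simp
qed

end

section \<open>Best approximation by fractal polynomials\<close>

text \<open>
  The fractal polynomials are the image of a finite-dimensional space under a linear map, hence the span
  of a finite set, and the theory of best approximation applies.
\<close>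

theorem theorem5p3:
  fixes p :: "3 \<Rightarrow> real^2"
    and SG :: "(real^2) set"
    and e :: "'a::topological_space \<Rightarrow> real^2"
    and \<mu> :: "'a measure"
    and N n :: nat
    and \<alpha> :: "3 list \<Rightarrow> ('a \<Rightarrow>\<^sub>C real)"
    and L :: "('a \<Rightarrow>\<^sub>C real) \<Rightarrow> ('a \<Rightarrow>\<^sub>C real)"
  assumes "equilateral p"
    and "SG \<noteq> {}" and "compact SG" and "SG = (\<Union>i. contraction p i ` SG)"
    and "homeomorphism UNIV SG e (inv e)"
    and "self_similar_measure p e \<mu>"
    and "N \<ge> 1"
    and "\<And>\<omega>. length \<omega> = N \<Longrightarrow> norm (\<alpha> \<omega>) < 1"
    and "bounded_linear L"
    and "\<And>f t. t \<in> boundary_vertices p e \<Longrightarrow> L f t = f t"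
  defines "W \<equiv> fractal_polynomials p e \<mu> N \<alpha> L n"
  shows "(proximinal W \<and> strongly_proximinal W) \<and>
    (\<forall>f. closed (metric_proj W f) \<and> convex (metric_proj W f)
         \<and> closedin weak_topology (metric_proj W f)) \<and>
    (upper_semicont_into W (metric_proj W) \<and> closed_graph (metric_proj W)
         \<and> locally_bounded (metric_proj W)) \<and>
    (\<exists>J. (\<forall>f. J f \<in> metric_proj W f) \<and> first_baire_class_into W J
         \<and> fsigma_in euclidean {f. \<not> isCont J f} \<and> first_category {f. \<not> isCont J f})"
proof -
  have "fractal_gasket_axioms p e N \<alpha> L"
    by (rule fractal_gasket_axioms.intro[OF assms(8) bounded_linear.linear[OF assms(9)] assms(10)])
  then interpret fractal_gasket p SG e N \<alpha> L
    by (rule fractal_gasket.intro[OF gasket.intro[OF assms(1-5)]])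
  interpret gasket_measure p SG e \<mu>
    by (rule gasket_measure.intro[OF gasket.intro[OF assms(1-5)] gasket_measure_axioms.intro])
      (use assms(6) in \<open>simp_all add: self_similar_measure_def\<close>)
  obtain B where B: "finite B" "span B = polynomials p e \<mu> n"
    using polynomials_finite_dim[of n] subspace_of_finite_span by metis
  have "W = span (fractal_operator p e N \<alpha> L ` B)"
    unfolding W_def fractal_polynomials_def B(2)[symmetric]
    by (rule linear_span_image[OF linear_fractal_operator, symmetric])
  then obtain q where "regularised_approximation W q"
    using regularised_approximation_span B(1) by blast
  then interpret W: regularised_approximation W q .
  have "first_category {f. \<not> isCont W.selector f}"
    by (rule first_category_discontinuities[OF W.continuous_minimiser W.minimiser_tendsto_selector]) simp
  then have "\<exists>J. (\<forall>f. J f \<in> metric_proj W f) \<and> first_baire_class_into W J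
      \<and> fsigma_in euclidean {f. \<not> isCont J f} \<and> first_category {f. \<not> isCont J f}"
    using W.selector(1) W.first_baire_selector fsigma_discontinuities by blast
  moreover have "closed (metric_proj W f) \<and> convex (metric_proj W f)
      \<and> closedin weak_topology (metric_proj W f)" for f
    using compact_imp_closed[OF W.compact_metric_proj] convex_metric_proj[OF W.convex_W]
      closedin_weak_compact[OF W.compact_metric_proj] by blast
  ultimately show ?thesis
    using W.proximinal W.strongly_proximinal W.upper_semicont W.closed_graph W.locally_bounded
    by blast
qed

end
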